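(* The functions $\tilde\Xi_\lambda$ ($\lambda$ ranging over all integer partitions) form a linear basis for the ring of symmetric functions over the rationals, and the functions $\tilde\Xi_{\lambda,\mu}$ ($\lambda,\mu$ ranging over all pairs of integer partitions) form a linear basis for the ring of symmetric functions in two sets of variables $x$ and $y$ over the rationals (i.e. for $\Lambda(x)\otimes\Lambda(y)$ over $\mathbb Q$).
   Context: For integer partitions $\lambda,\mu$, $D_{\lambda,\mu}$ is the digraph which is a disjoint union of directed paths and directed cycles such that the $i$th directed path has $\lambda_i$ vertices and the $j$th directed cycle has $\mu_j$ vertices (a cycle of length one is a loop; a cycle of length two is a pair of opposite edges). A path-cycle cover of a digraph is a subset $S$ of its edges such that the spanning subgraph with edge set $S$ is a vertex-disjoint union of directed paths and directed cycles (isolated vertices are directed paths with no edges). $\pi(S)$ and $\sigma(S)$ are the sets of vertex sets of the paths and cycles respectively, $\ell(\pi(S))$ is the number of paths, and a set partition in a subscript stands for the integer partition of its block sizes. With $\tilde m_\lambda=(r_1!r_2!\cdots)m_\lambda$ ($r_i$ the number of parts of $\lambda$ equal to $i$), $p_\lambda$ the power sums, and $x,y$ two countably infinite sets of commuting indeterminates, $$\tilde\Xi_{\lambda,\mu}=\sum_S\frac{\tilde m_{\pi(S)}(x)\,p_{\sigma(S)}(y)}{\ell(\pi(S))!},$$ the sum over all path-cycle covers $S$ of $D_{\lambda,\mu}$, and $\tilde\Xi_\lambda=\tilde\Xi_{\lambda,\varnothing}$ (a symmetric function in $x$ only). *)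

theory Defs
  imports
    "HOL-Library.Poly_Mapping"
    "HOL-Library.Multiset"
    "HOL-Combinatorics.Permutations"
    Complex_Main
begin

section \<open>Formal power series in arbitrarily many commuting indeterminates\<close>

text \<open>
  The indeterminates are the elements of an arbitrary type \<open>'v\<close>, a monomial is its exponent
  function, and a series assigns a coefficient to every monomial.  Infinitely many monomials
  may have a nonzero coefficient.
\<close>

type_synonym 'v monomial = "'v \<Rightarrow>\<^sub>0 nat"

typedef ('v, 'a) mfps = "UNIV :: ('v monomial \<Rightarrow> 'a) set"
  morphisms mcoeff Abs_mfps ..

setup_lifting type_definition_mfps

lemma finite_monomial_splittings:
  fixes \<alpha> :: "'v monomial"
  shows "finite {(\<beta>, \<gamma>). \<beta> + \<gamma> = \<alpha>}"
proof -
  let ?K = "Poly_Mapping.keys \<alpha>"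
  let ?N = "Max (Poly_Mapping.lookup \<alpha> ` ?K)"
  define F where "F = {f. (\<forall>x. x \<in> ?K \<longrightarrow> f x \<in> {..?N}) \<and> (\<forall>x. x \<notin> ?K \<longrightarrow> f x = (0::nat))}"
  have fF: "finite F"
    unfolding F_def using finite_set_of_finite_funs[of ?K "{..?N}" 0] by (simp add: all_conj_distrib)
  have sub: "Poly_Mapping.lookup \<beta> \<in> F" if "\<beta> + \<gamma> = \<alpha>" for \<beta> \<gamma>
  proof -
    have le: "Poly_Mapping.lookup \<beta> x \<le> Poly_Mapping.lookup \<alpha> x" for x
      using that by (metis le_add1 lookup_add)
    have "Poly_Mapping.lookup \<beta> x \<le> ?N" if "x \<in> ?K" for x
      using le[of x] that by (meson Max_ge finite_imageI finite_keys image_eqI le_trans)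
    moreover have "Poly_Mapping.lookup \<beta> x = 0" if "x \<notin> ?K" for x
      using le[of x] that by (simp add: in_keys_iff)
    ultimately show ?thesis by (simp add: F_def)
  qed
  have "inj_on (\<lambda>(\<beta>, \<gamma>). Poly_Mapping.lookup \<beta>) {(\<beta>, \<gamma>). \<beta> + \<gamma> = \<alpha>}"
    by (auto simp: inj_on_def poly_mapping.lookup_inject)
  moreover have "(\<lambda>(\<beta>, \<gamma>). Poly_Mapping.lookup \<beta>) ` {(\<beta>, \<gamma>). \<beta> + \<gamma> = \<alpha>} \<subseteq> F"
    using sub by auto
  ultimately show ?thesis
    using fF by (metis finite_imageD finite_subset)
qed

instantiation mfps :: (type, comm_ring_1) comm_ring_1
begin

lift_definition zero_mfps :: "('a, 'b) mfps" is "\<lambda>_. 0" .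
lift_definition one_mfps :: "('a, 'b) mfps" is "\<lambda>\<alpha>. if \<alpha> = 0 then 1 else 0" .
lift_definition plus_mfps :: "('a, 'b) mfps \<Rightarrow> ('a, 'b) mfps \<Rightarrow> ('a, 'b) mfps"
  is "\<lambda>f g \<alpha>. f \<alpha> + g \<alpha>" .
lift_definition minus_mfps :: "('a, 'b) mfps \<Rightarrow> ('a, 'b) mfps \<Rightarrow> ('a, 'b) mfps"
  is "\<lambda>f g \<alpha>. f \<alpha> - g \<alpha>" .
lift_definition uminus_mfps :: "('a, 'b) mfps \<Rightarrow> ('a, 'b) mfps"
  is "\<lambda>f \<alpha>. - f \<alpha>" .
lift_definition times_mfps :: "('a, 'b) mfps \<Rightarrow> ('a, 'b) mfps \<Rightarrow> ('a, 'b) mfps"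
  is "\<lambda>f g \<alpha>. \<Sum>(\<beta>, \<gamma>) | \<beta> + \<gamma> = \<alpha>. f \<beta> * g \<gamma>" .

instance
proof
  fix a b c :: "('a, 'b) mfps"
  show "a + b + c = a + (b + c)" by transfer (auto simp: add.assoc)
  show "a + b = b + a" by transfer (auto simp: add.commute)
  show "0 + a = a" by transfer auto
  show "- a + a = 0" by transfer auto
  show "a - b = a + - b" by transfer auto
  show "(0::('a, 'b) mfps) \<noteq> 1"
    by transfer (metis zero_neq_one)
  show "(a + b) * c = a * c + b * c"
    by transfer (auto simp: fun_eq_iff sum.distrib[symmetric] distrib_right split_def)
  show "a * b = b * a"
  proof (transfer, rule ext)
    fix f g :: "'a monomial \<Rightarrow> 'b" and \<alpha> :: "'a monomial"
    show "(\<Sum>(\<beta>, \<gamma>) | \<beta> + \<gamma> = \<alpha>. f \<beta> * g \<gamma>) = (\<Sum>(\<beta>, \<gamma>) | \<beta> + \<gamma> = \<alpha>. g \<beta> * f \<gamma>)"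
      by (rule sum.reindex_bij_witness[where i = prod.swap and j = prod.swap])
        (auto simp: ac_simps)
  qed
  show "1 * a = a"
  proof (transfer, rule ext)
    fix f :: "'a monomial \<Rightarrow> 'b" and \<alpha> :: "'a monomial"
    have "(\<Sum>(\<beta>, \<gamma>) | \<beta> + \<gamma> = \<alpha>. (if \<beta> = 0 then 1 else 0) * f \<gamma>)
        = sum (\<lambda>(\<beta>, \<gamma>). (if \<beta> = 0 then 1 else 0) * f \<gamma>) {(0 :: 'a monomial, \<alpha>)}"
      by (intro sum.mono_neutral_right finite_monomial_splittings) (auto split: if_splits)
    then show "(\<Sum>(\<beta>, \<gamma>) | \<beta> + \<gamma> = \<alpha>. (if \<beta> = 0 then 1 else 0) * f \<gamma>) = f \<alpha>"
      by simp
  qed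
  show "a * b * c = a * (b * c)"
  proof (transfer, rule ext)
    fix f g h :: "'a monomial \<Rightarrow> 'b" and \<alpha> :: "'a monomial"
    have "(\<Sum>(\<beta>, \<gamma>) | \<beta> + \<gamma> = \<alpha>. (\<Sum>(\<delta>, \<epsilon>) | \<delta> + \<epsilon> = \<beta>. f \<delta> * g \<epsilon>) * h \<gamma>)
        = (\<Sum>(p, q) \<in> (SIGMA p:{(\<beta>, \<gamma>). \<beta> + \<gamma> = \<alpha>}. {(\<delta>, \<epsilon>). \<delta> + \<epsilon> = fst p}).
             f (fst q) * g (snd q) * h (snd p))"
      by (subst sum.Sigma[symmetric])
        (auto simp: finite_monomial_splittings[unfolded split_def] sum_distrib_right split_def intro!: sum.cong)
    also have "\<dots> = (\<Sum>(p, q) \<in> (SIGMA p:{(\<beta>, \<gamma>). \<beta> + \<gamma> = \<alpha>}. {(\<delta>, \<epsilon>). \<delta> + \<epsilon> = snd p}).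
             f (fst p) * (g (fst q) * h (snd q)))"
      by (rule sum.reindex_bij_witness[where
            i = "\<lambda>(p, q). ((fst p + fst q, snd q), (fst p, fst q))" and
            j = "\<lambda>(p, q). ((fst q, snd q + snd p), (snd q, snd p))"])
        (auto simp: ac_simps)
    also have "\<dots> = (\<Sum>(\<beta>, \<gamma>) | \<beta> + \<gamma> = \<alpha>. f \<beta> * (\<Sum>(\<delta>, \<epsilon>) | \<delta> + \<epsilon> = \<gamma>. g \<delta> * h \<epsilon>))"
      by (subst sum.Sigma[symmetric])
        (auto simp: finite_monomial_splittings[unfolded split_def] sum_distrib_left split_def intro!: sum.cong)
    finally show "(\<Sum>(\<beta>, \<gamma>) | \<beta> + \<gamma> = \<alpha>. (\<Sum>(\<delta>, \<epsilon>) | \<delta> + \<epsilon> = \<beta>. f \<delta> * g \<epsilon>) * h \<gamma>)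
        = (\<Sum>(\<beta>, \<gamma>) | \<beta> + \<gamma> = \<alpha>. f \<beta> * (\<Sum>(\<delta>, \<epsilon>) | \<delta> + \<epsilon> = \<gamma>. g \<delta> * h \<epsilon>))" .
  qed
qed

end

lift_definition mscale :: "'a::comm_ring_1 \<Rightarrow> ('v, 'a) mfps \<Rightarrow> ('v, 'a) mfps"
  is "\<lambda>c f \<alpha>. c * f \<alpha>" .

interpretation mfps: vector_space "mscale :: rat \<Rightarrow> ('v, rat) mfps \<Rightarrow> _"
  by unfold_locales (transfer; auto simp: fun_eq_iff algebra_simps)+

definition is_linear_basis :: "('i \<Rightarrow> ('v, rat) mfps) \<Rightarrow> 'i set \<Rightarrow> ('v, rat) mfps set \<Rightarrow> bool" where
  "is_linear_basis b I W \<longleftrightarrow>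
     inj_on b I \<and> mfps.independent (b ` I) \<and> mfps.span (b ` I) = W"


section \<open>Symmetric functions\<close>

definition mdegree :: "'v monomial \<Rightarrow> nat" where
  "mdegree \<alpha> = (\<Sum>v\<in>Poly_Mapping.keys \<alpha>. Poly_Mapping.lookup \<alpha> v)"

definition bounded_degree :: "('v, rat) mfps \<Rightarrow> bool" where
  "bounded_degree f \<longleftrightarrow> (\<exists>d. \<forall>\<alpha>. mcoeff f \<alpha> \<noteq> 0 \<longrightarrow> mdegree \<alpha> \<le> d)"

text \<open>
  For a family \<open>\<V>\<close> of disjoint sets of indeterminates, \<open>symmetric_functions \<V>\<close> consists of the
  series of bounded degree in the indeterminates \<open>\<Union>\<V>\<close> that are symmetric in each \<open>V \<in> \<V>\<close>
  separately.  For two infinite sets it is the tensor product of the two rings of symmetric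
  functions, realised inside the power series by \<open>f(x) \<otimes> g(y) \<mapsto> f(x) g(y)\<close>.
\<close>

definition symmetric_functions :: "'v set set \<Rightarrow> ('v, rat) mfps set" where
  "symmetric_functions \<V> = {f. bounded_degree f \<and>
     (\<forall>\<alpha>. mcoeff f \<alpha> \<noteq> 0 \<longrightarrow> Poly_Mapping.keys \<alpha> \<subseteq> \<Union>\<V>) \<and>
     (\<forall>V\<in>\<V>. \<forall>\<tau>. \<tau> permutes V \<longrightarrow>
        (\<forall>\<alpha>. mcoeff f (Poly_Mapping.map_key \<tau> \<alpha>) = mcoeff f \<alpha>))}"

text \<open>An integer partition is the multiset of its (positive) parts.\<close>

definition partitions :: "nat multiset set" where
  "partitions = {lam. 0 \<notin># lam}"

definition exponents :: "'v monomial \<Rightarrow> nat multiset" where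
  "exponents \<alpha> = image_mset (Poly_Mapping.lookup \<alpha>) (mset_set (Poly_Mapping.keys \<alpha>))"

definition monomial_sym :: "'v set \<Rightarrow> nat multiset \<Rightarrow> ('v, rat) mfps" where
  "monomial_sym V lam =
     Abs_mfps (\<lambda>\<alpha>. if Poly_Mapping.keys \<alpha> \<subseteq> V \<and> exponents \<alpha> = lam then 1 else 0)"

definition augmented_monomial_sym :: "'v set \<Rightarrow> nat multiset \<Rightarrow> ('v, rat) mfps" where
  "augmented_monomial_sym V lam =
     mscale (\<Prod>k\<in>set_mset lam. fact (count lam k)) (monomial_sym V lam)"

definition power_sum :: "'v set \<Rightarrow> nat \<Rightarrow> ('v, rat) mfps" where
  "power_sum V k = Abs_mfps (\<lambda>\<alpha>. if \<exists>v\<in>V. \<alpha> = Poly_Mapping.single v k then 1 else 0)"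

definition power_sum_sym :: "'v set \<Rightarrow> nat multiset \<Rightarrow> ('v, rat) mfps" where
  "power_sum_sym V lam = (\<Prod>k\<in>#lam. power_sum V k)"


section \<open>Path-cycle covers\<close>

text \<open>A digraph without multiple edges is given by its vertex set and its set of edges.\<close>

type_synonym 'a edges = "('a \<times> 'a) set"

definition is_dipath :: "'a set \<Rightarrow> 'a edges \<Rightarrow> bool" where
  "is_dipath V E \<longleftrightarrow>
     (\<exists>vs. vs \<noteq> [] \<and> distinct vs \<and> set vs = V \<and> E = set (zip vs (tl vs)))"

definition is_dicycle :: "'a set \<Rightarrow> 'a edges \<Rightarrow> bool" where
  "is_dicycle V E \<longleftrightarrow>
     (\<exists>vs. vs \<noteq> [] \<and> distinct vs \<and> set vs = V \<and> E = set (zip vs (rotate1 vs)))"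

text \<open>The vertex sets of the (weakly) connected components.\<close>

definition components :: "'a set \<Rightarrow> 'a edges \<Rightarrow> 'a set set" where
  "components V E = V // (E \<union> E\<inverse>)\<^sup>*"

definition path_blocks :: "'a set \<Rightarrow> 'a edges \<Rightarrow> 'a set set" where
  "path_blocks V S = {B \<in> components V S. is_dipath B (S \<inter> B \<times> B)}"

definition cycle_blocks :: "'a set \<Rightarrow> 'a edges \<Rightarrow> 'a set set" where
  "cycle_blocks V S = {B \<in> components V S. is_dicycle B (S \<inter> B \<times> B)}"

definition path_cycle_covers :: "'a set \<Rightarrow> 'a edges \<Rightarrow> 'a edges set" where
  "path_cycle_covers V E =
     {S. S \<subseteq> E \<and> (\<forall>B\<in>components V S. is_dipath B (S \<inter> B \<times> B) \<or> is_dicycle B (S \<inter> B \<times> B))}"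

definition block_sizes :: "'a set set \<Rightarrow> nat multiset" where
  "block_sizes P = image_mset card (mset_set P)"


section \<open>The digraphs of paths and cycles and their symmetric functions\<close>

definition parts :: "nat multiset \<Rightarrow> nat list" where
  "parts lam = rev (sorted_list_of_multiset lam)"

text \<open>
  \<open>Inl (i, j)\<close> is the \<open>j\<close>th vertex of the \<open>i\<close>th path and \<open>Inr (i, j)\<close> the \<open>j\<close>th vertex of
  the \<open>i\<close>th cycle, all indices starting from \<open>0\<close>.
\<close>

type_synonym pc_vertex = "nat \<times> nat + nat \<times> nat"

definition pc_verts :: "nat multiset \<Rightarrow> nat multiset \<Rightarrow> pc_vertex set" where
  "pc_verts lam mu =
     {Inl (i, j) | i j. i < length (parts lam) \<and> j < parts lam ! i} \<union>
     {Inr (i, j) | i j. i < length (parts mu) \<and> j < parts mu ! i}"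

definition pc_edges :: "nat multiset \<Rightarrow> nat multiset \<Rightarrow> pc_vertex edges" where
  "pc_edges lam mu =
     {(Inl (i, j), Inl (i, j + 1)) | i j. i < length (parts lam) \<and> j + 1 < parts lam ! i} \<union>
     {(Inr (i, j), Inr (i, (j + 1) mod (parts mu ! i))) | i j.
        i < length (parts mu) \<and> j < parts mu ! i}"

text \<open>The indeterminates \<open>x\<^sub>n\<close> and \<open>y\<^sub>n\<close> are \<open>Inl n\<close> and \<open>Inr n\<close>.\<close>

type_synonym indet = "nat + nat"

definition x_vars :: "indet set" where "x_vars = range Inl"
definition y_vars :: "indet set" where "y_vars = range Inr"

definition Xi_tilde2 :: "nat multiset \<Rightarrow> nat multiset \<Rightarrow> (indet, rat) mfps" where
  "Xi_tilde2 lam mu =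
     (\<Sum>S\<in>path_cycle_covers (pc_verts lam mu) (pc_edges lam mu).
        let \<pi> = path_blocks (pc_verts lam mu) S; \<sigma> = cycle_blocks (pc_verts lam mu) S in
        mscale (1 / fact (card \<pi>))
          (augmented_monomial_sym x_vars (block_sizes \<pi>) * power_sum_sym y_vars (block_sizes \<sigma>)))"

definition Xi_tilde :: "nat multiset \<Rightarrow> (indet, rat) mfps" where
  "Xi_tilde lam = Xi_tilde2 lam {#}"

end

theory Submission
  imports Defs
begin

text \<open>
  Both families are obtained from a known basis by a triangular change of basis with nonzero
  diagonal entries, where \<open>D\<close> below denotes the digraph with path lengths \<open>\<lambda>\<close> and cycle
  lengths \<open>\<mu>\<close>.

  In a path-cycle cover \<open>S\<close> every path has one vertex more than it has edges and every cycle has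
  as many vertices as edges, so the number of paths of \<open>S\<close> is the number of vertices of \<open>D\<close>
  minus the number of edges in \<open>S\<close>.  Taking all edges of \<open>D\<close> gives a cover whose paths and
  cycles are those of \<open>D\<close>, and every other cover has fewer edges, hence more paths.
  Therefore the function attached to \<open>(\<lambda>, \<mu>)\<close> is a nonzero multiple of
  \<open>m\<^sub>\<lambda>(x) p\<^sub>\<mu>(y)\<close> plus a combination of products \<open>m\<^sub>\<alpha>(x) p\<^sub>\<beta>(y)\<close> with
  \<open>\<bar>\<alpha>\<bar> + \<bar>\<beta>\<bar> = \<bar>\<lambda>\<bar> + \<bar>\<mu>\<bar>\<close> and with \<open>\<alpha>\<close> having more parts than \<open>\<lambda>\<close>
  (\<open>Xi_tilde2_triangular\<close>).  If \<open>\<mu>\<close> is empty, then no cover contains a cycle and every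
  \<open>\<beta>\<close> is empty, so that the same expansion takes place within the functions of \<open>x\<close>.

  The products \<open>m\<^sub>\<lambda>(x) p\<^sub>\<mu>(y)\<close> form a basis for a similar reason: \<open>p\<^sub>\<mu>\<close> is a positive
  multiple of \<open>m\<^sub>\<mu>\<close> plus a combination of functions \<open>m\<^sub>\<nu>\<close> where \<open>\<nu>\<close> has fewer parts than
  \<open>\<mu>\<close> (\<open>power_sum_sym_leading_term\<close>, \<open>mixed_product_triangular\<close>).  Finally, two monomials
  differ by permutations of the \<open>x\<close> and of the \<open>y\<close> exactly if their exponents in the \<open>x\<close> and in
  the \<open>y\<close> agree as multisets.  So the products \<open>m\<^sub>\<lambda>(x) m\<^sub>\<nu>(y)\<close> are the sums over the classes of
  this equivalence, and they are a basis of the series of bounded degree that are constant on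
  the classes (\<open>class_sum_basis1\<close>, \<open>class_sum_basis2\<close>).
\<close>

section \<open>Triangular changes of basis\<close>

context vector_space
begin

text \<open>
  Exchanging injectivity and independence for one condition on the family lets both be
  transported at once along a change of basis.
\<close>

lemma inj_on_independent_image_iff:
  "inj_on b I \<and> independent (b ` I) \<longleftrightarrow> (\<forall>i\<in>I. b i \<notin> span (b ` (I - {i})))"
proof
  assume L: "inj_on b I \<and> independent (b ` I)"
  show "\<forall>i\<in>I. b i \<notin> span (b ` (I - {i}))"
  proof
    fix i assume i: "i \<in> I"
    have "b ` (I - {i}) = b ` I - {b i}"
      using L i by (auto simp: inj_on_def)
    then show "b i \<notin> span (b ` (I - {i}))"
      using L i by (auto simp: dependent_def)
  qed
next
  assume R: "\<forall>i\<in>I. b i \<notin> span (b ` (I - {i}))"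
  have inj: "inj_on b I"
  proof (rule inj_onI, rule ccontr)
    fix i j assume "i \<in> I" "j \<in> I" "b i = b j" "i \<noteq> j"
    then have "b i \<in> b ` (I - {i})" by auto
    then have "b i \<in> span (b ` (I - {i}))" by (rule span_base)
    then show False using R \<open>i \<in> I\<close> by simp
  qed
  have "b ` (I - {i}) = b ` I - {b i}" if "i \<in> I" for i
    using inj that by (auto simp: inj_on_def)
  then show "inj_on b I \<and> independent (b ` I)"
    using inj R by (auto simp: dependent_def)
qed

lemma in_span_imageE:
  assumes "x \<in> span (b ` J)"
  obtains F u where "finite F" "F \<subseteq> J" "x = (\<Sum>j\<in>F. u j *s b j)"
proof -
  obtain T r where T: "finite T" "T \<subseteq> b ` J" "x = (\<Sum>a\<in>T. r a *s a)"
    using assms unfolding span_explicit by auto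
  obtain F where F: "F \<subseteq> J" "T = b ` F" "inj_on b F"
    using T(2) by (metis subset_image_inj)
  have "finite F" using T(1) F(2,3) finite_image_iff by blast
  moreover have "x = (\<Sum>j\<in>F. r (b j) *s b j)"
    using T(3) F(2,3) by (simp add: sum.reindex)
  ultimately show thesis using that F(1) by metis
qed

text \<open>
  In a vanishing combination of the \<open>b i\<close>, an index \<open>i\<close> of maximal rank among those with a
  nonzero coefficient is the only one whose expansion involves \<open>c i\<close>; this would express
  \<open>c i\<close> by the other \<open>c j\<close>.  Conversely, induction on the rank solves the equations for the
  \<open>c i\<close>.
\<close>

lemma triangular_basis_change:
  fixes rank :: "'i \<Rightarrow> nat"
  assumes c: "inj_on c I" "independent (c ` I)"
    and tri: "\<And>i. i \<in> I \<Longrightarrow>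
      \<exists>a. a \<noteq> 0 \<and> b i - a *s c i \<in> span (c ` {j \<in> I. rank j < rank i})"
  shows "inj_on b I \<and> independent (b ` I) \<and> span (b ` I) = span (c ` I)"
proof -
  define low where "low i = {j \<in> I. rank j < rank i}" for i
  have "\<exists>a. \<forall>i\<in>I. a i \<noteq> 0 \<and> b i - a i *s c i \<in> span (c ` low i)"
    unfolding low_def by (intro bchoice ballI tri)
  then obtain a where a: "\<And>i. i \<in> I \<Longrightarrow> a i \<noteq> 0"
    and lower: "\<And>i. i \<in> I \<Longrightarrow> b i - a i *s c i \<in> span (c ` low i)"
    by blast
  have unscale: "x \<in> span S" if "z \<noteq> 0" "z *s x \<in> span S" for z x S
    using span_scale[OF that(2), of "inverse z"] that(1) by simp
  have c_notin: "c i \<notin> span (c ` (I - {i}))" if "i \<in> I" for i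
    using inj_on_independent_image_iff[of c I] c that by simp
  have b_notin: "b i \<notin> span (b ` (I - {i}))" if i: "i \<in> I" for i
  proof
    assume "b i \<in> span (b ` (I - {i}))"
    then obtain F u where F: "finite F" "F \<subseteq> I - {i}" and bi: "b i = (\<Sum>j\<in>F. u j *s b j)"
      by (rule in_span_imageE)
    \<comment> \<open>The coefficient \<open>- 1\<close> moves \<open>b i\<close> to the other side, which leaves a vanishing combination.\<close>
    define w where "w j = (if j = i then - 1 else u j)" for j
    have "(\<Sum>j\<in>insert i F. w j *s b j) = - b i + (\<Sum>j\<in>F. w j *s b j)"
      using F by (subst sum.insert) (auto simp: w_def)
    also have "(\<Sum>j\<in>F. w j *s b j) = (\<Sum>j\<in>F. u j *s b j)"
      using F by (intro sum.cong) (auto simp: w_def)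
    finally have zero: "(\<Sum>j\<in>insert i F. w j *s b j) = 0"
      using bi by simp
    define G where "G = {j \<in> insert i F. w j \<noteq> 0}"
    have G: "finite G" "i \<in> G" "G \<subseteq> I"
      using F i by (auto simp: G_def w_def)
    have zero: "(\<Sum>j\<in>G. w j *s b j) = 0"
      unfolding zero[symmetric] by (rule sum.mono_neutral_left) (use F in \<open>auto simp: G_def\<close>)
    have "Max (rank ` G) \<in> rank ` G"
      using G(1,2) by (intro Max_in) auto
    then obtain k where k: "k \<in> G" and "rank k = Max (rank ` G)"
      by auto
    then have kmax: "rank j \<le> rank k" if "j \<in> G" for j
      using G(1) that by simp
    have kI: "k \<in> I" and wk: "w k \<noteq> 0" using k G by (auto simp: G_def)
    let ?U = "span (c ` (I - {k}))"
    have mono: "x \<in> ?U" if "x \<in> span (c ` J)" "J \<subseteq> I - {k}" for x J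
      using that span_mono[of "c ` J" "c ` (I - {k})"] by auto
    have rest: "b j \<in> ?U" if "j \<in> G - {k}" for j
    proof -
      have jI: "j \<in> I" using that G by auto
      have "low j \<subseteq> I - {k}" using kmax[of j] that by (auto simp: low_def)
      then have "b j - a j *s c j \<in> ?U" using lower[OF jI] mono by simp
      moreover have "a j *s c j \<in> ?U" using that jI by (intro span_scale span_base) auto
      ultimately have "(b j - a j *s c j) + a j *s c j \<in> ?U" by (rule span_add)
      then show ?thesis by simp
    qed
    have "low k \<subseteq> I - {k}" by (auto simp: low_def)
    then have lowk: "b k - a k *s c k \<in> ?U" using lower[OF kI] mono by simp
    have "(w k * a k) *s c k
        = (\<Sum>j\<in>G. w j *s b j) - (\<Sum>j\<in>G - {k}. w j *s b j) - w k *s (b k - a k *s c k)"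
      using G(1) k by (simp add: sum.remove scale_right_diff_distrib)
    also have "\<dots> \<in> ?U"
      unfolding zero by (intro span_diff span_zero span_sum span_scale rest lowk)
    finally have "c k \<in> ?U" by (rule unscale[rotated]) (use wk a[OF kI] in simp)
    then show False using c_notin[OF kI] by simp
  qed
  have "b i \<in> span (c ` I)" if "i \<in> I" for i
  proof -
    have "b i - a i *s c i \<in> span (c ` I)"
      using lower[OF that] span_mono[of "c ` low i" "c ` I"] by (auto simp: low_def)
    moreover have "a i *s c i \<in> span (c ` I)" using that by (intro span_scale span_base) auto
    ultimately have "(b i - a i *s c i) + a i *s c i \<in> span (c ` I)" by (rule span_add)
    then show ?thesis by simp
  qed
  then have le: "span (b ` I) \<subseteq> span (c ` I)" by (intro span_minimal) auto
  have "i \<in> I \<Longrightarrow> c i \<in> span (b ` I)" for i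
  proof (induction "rank i" arbitrary: i rule: less_induct)
    case less
    have "c ` low i \<subseteq> span (b ` I)" using less by (auto simp: low_def)
    then have "b i - a i *s c i \<in> span (b ` I)"
      using lower[OF less.prems] span_minimal[OF _ subspace_span, of "c ` low i" "b ` I"] by blast
    moreover have "b i \<in> span (b ` I)" using less.prems by (intro span_base) auto
    ultimately have "b i - (b i - a i *s c i) \<in> span (b ` I)" by (rule span_diff[rotated])
    then have "a i *s c i \<in> span (b ` I)" by simp
    then show ?case by (rule unscale[OF a[OF less.prems]])
  qed
  then have "span (c ` I) \<subseteq> span (b ` I)" by (intro span_minimal) auto
  with le have "span (b ` I) = span (c ` I)" by (rule equalityI)
  moreover have "inj_on b I \<and> independent (b ` I)"
    unfolding inj_on_independent_image_iff using b_notin by blast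
  ultimately show ?thesis by blast
qed

end

lemma triangular_is_linear_basis:
  fixes rank :: "'i \<Rightarrow> nat"
  assumes "is_linear_basis c I W"
    and "\<And>i. i \<in> I \<Longrightarrow>
      \<exists>a. a \<noteq> 0 \<and> b i - mscale a (c i) \<in> mfps.span (c ` {j \<in> I. rank j < rank i})"
  shows "is_linear_basis b I W"
proof -
  have "inj_on c I" "mfps.independent (c ` I)" "mfps.span (c ` I) = W"
    using assms(1) by (simp_all add: is_linear_basis_def)
  with mfps.triangular_basis_change[OF this(1,2) assms(2)] show ?thesis
    by (simp add: is_linear_basis_def)
qed


section \<open>Coefficients and classes of monomials\<close>

lemma mcoeff_simps [simp]:
  "mcoeff 0 \<alpha> = 0"
  "mcoeff (f + g) \<alpha> = mcoeff f \<alpha> + mcoeff g \<alpha>"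
  "mcoeff (f - g) \<alpha> = mcoeff f \<alpha> - mcoeff g \<alpha>"
  "mcoeff (mscale c f) \<alpha> = c * mcoeff f \<alpha>"
  by (simp_all add: zero_mfps.rep_eq plus_mfps.rep_eq minus_mfps.rep_eq mscale.rep_eq)

lemma mcoeff_one: "mcoeff 1 \<alpha> = (if \<alpha> = 0 then 1 else 0)"
  by (simp add: one_mfps.rep_eq)

lemma mcoeff_times: "mcoeff (f * g) \<alpha> = (\<Sum>(\<beta>, \<gamma>) | \<beta> + \<gamma> = \<alpha>. mcoeff f \<beta> * mcoeff g \<gamma>)"
  by (simp add: times_mfps.rep_eq)

lemma mcoeff_Abs [simp]: "mcoeff (Abs_mfps f) \<alpha> = f \<alpha>"
  by (simp add: Abs_mfps_inverse)

lemma mcoeff_sum [simp]: "mcoeff (sum f A) \<alpha> = (\<Sum>i\<in>A. mcoeff (f i) \<alpha>)"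
  by (induction A rule: infinite_finite_induct) auto

lemma mfps_eqI: "(\<And>\<alpha>. mcoeff f \<alpha> = mcoeff g \<alpha>) \<Longrightarrow> f = g"
  by (metis ext mcoeff_inject)

lemma mscale_times_left: "mscale c f * g = mscale c (f * g)"
  by (rule mfps_eqI) (auto simp: mcoeff_times sum_distrib_left mult.assoc intro!: sum.cong)

lemma mscale_mscale: "mscale c (mscale d f) = mscale (c * d) f"
  by (rule mfps_eqI) (simp add: mult.assoc)

lemma mcoeff_times_nonzeroE:
  fixes f g :: "('v, rat) mfps"
  assumes "mcoeff (f * g) \<alpha> \<noteq> 0"
  obtains \<beta> \<gamma> where "\<alpha> = \<beta> + \<gamma>" "mcoeff f \<beta> \<noteq> 0" "mcoeff g \<gamma> \<noteq> 0"
proof -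
  obtain p where "p \<in> {(\<beta>, \<gamma>). \<beta> + \<gamma> = \<alpha>}"
    and "(case p of (\<beta>, \<gamma>) \<Rightarrow> mcoeff f \<beta> * mcoeff g \<gamma>) \<noteq> 0"
    using assms unfolding mcoeff_times by (rule sum.not_neutral_contains_not_neutral)
  then show thesis using that[of "fst p" "snd p"] by (auto simp: split_def)
qed

text \<open>
  For the classification of monomials by their exponents up to order this is a monomial symmetric
  function, and for the classification by the exponents in two sets of indeterminates it is a
  product of two of them.  Expansion and independence depend on the classification alone.
\<close>

definition class_sum :: "('v monomial \<Rightarrow> 'i) \<Rightarrow> 'i \<Rightarrow> ('v, rat) mfps" where
  "class_sum t i = Abs_mfps (\<lambda>\<alpha>. if t \<alpha> = i then 1 else 0)"

text \<open>
  The coefficient of \<open>f\<close> on a class, read off at any representative, is the coefficient of the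
  class sum; finitely many classes are needed because a span consists of finite sums.
\<close>

lemma in_span_class_sum:
  assumes const: "\<And>\<alpha> \<beta>. t \<alpha> = t \<beta> \<Longrightarrow> mcoeff f \<alpha> = mcoeff f \<beta>"
    and fin: "finite {t \<alpha> | \<alpha>. mcoeff f \<alpha> \<noteq> 0}"
    and sub: "\<And>\<alpha>. mcoeff f \<alpha> \<noteq> 0 \<Longrightarrow> t \<alpha> \<in> J"
  shows "f \<in> mfps.span (class_sum t ` J)"
proof -
  let ?T = "{t \<alpha> | \<alpha>. mcoeff f \<alpha> \<noteq> 0}"
  define rep where "rep i = (SOME \<alpha>. t \<alpha> = i)" for i
  have rep: "t (rep (t \<alpha>)) = t \<alpha>" for \<alpha>
    unfolding rep_def by (rule someI) simp
  have "f = (\<Sum>i\<in>?T. mscale (mcoeff f (rep i)) (class_sum t i))"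
  proof (rule mfps_eqI)
    fix \<alpha>
    have "mcoeff (\<Sum>i\<in>?T. mscale (mcoeff f (rep i)) (class_sum t i)) \<alpha>
        = (\<Sum>i\<in>?T. if t \<alpha> = i then mcoeff f (rep i) else 0)"
      by (auto simp: class_sum_def intro!: sum.cong)
    also have "\<dots> = (if t \<alpha> \<in> ?T then mcoeff f (rep (t \<alpha>)) else 0)"
      using fin by (simp add: sum.delta)
    also have "\<dots> = mcoeff f \<alpha>"
      using const[OF rep, of \<alpha>] by auto
    finally show "mcoeff f \<alpha> = mcoeff (\<Sum>i\<in>?T. mscale (mcoeff f (rep i)) (class_sum t i)) \<alpha>"
      by simp
  qed
  also have "\<dots> \<in> mfps.span (class_sum t ` J)"
    using sub by (intro mfps.span_sum mfps.span_scale mfps.span_base) auto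
  finally show ?thesis .
qed

text \<open>
  The coefficient at a monomial of class \<open>i\<close> vanishes on all class sums except that of \<open>i\<close>.
\<close>

lemma class_sum_independent:
  assumes "I \<subseteq> range t"
  shows "inj_on (class_sum t) I \<and> mfps.independent (class_sum t ` I)"
  unfolding mfps.inj_on_independent_image_iff
proof
  fix i assume i: "i \<in> I"
  obtain \<alpha> where \<alpha>: "t \<alpha> = i" using i assms by auto
  have "mfps.subspace {f :: (_, rat) mfps. mcoeff f \<alpha> = 0}"
    by (auto simp: mfps.subspace_def)
  then have "mfps.span (class_sum t ` (I - {i})) \<subseteq> {f. mcoeff f \<alpha> = 0}"
    by (intro mfps.span_minimal) (auto simp: class_sum_def \<alpha>)
  moreover have "mcoeff (class_sum t i) \<alpha> = 1" by (simp add: class_sum_def \<alpha>)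
  ultimately show "class_sum t i \<notin> mfps.span (class_sum t ` (I - {i}))" by auto
qed


section \<open>Monomials over a set of indeterminates\<close>

abbreviation keys :: "'v monomial \<Rightarrow> 'v set" where
  "keys \<equiv> Poly_Mapping.keys"

abbreviation lookup :: "'v monomial \<Rightarrow> 'v \<Rightarrow> nat" where
  "lookup \<equiv> Poly_Mapping.lookup"

abbreviation map_key :: "('v \<Rightarrow> 'v) \<Rightarrow> 'v monomial \<Rightarrow> 'v monomial" where
  "map_key \<equiv> Poly_Mapping.map_key"

abbreviation single :: "'v \<Rightarrow> nat \<Rightarrow> 'v monomial" where
  "single \<equiv> Poly_Mapping.single"

lift_definition restrict_monomial :: "'v set \<Rightarrow> 'v monomial \<Rightarrow> 'v monomial"
  is "\<lambda>V f v. if v \<in> V then f v else 0"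
  by (rule finite_subset[rotated]) auto

lemma lookup_restrict_monomial [simp]:
  "lookup (restrict_monomial V \<alpha>) v = (if v \<in> V then lookup \<alpha> v else 0)"
  by (simp add: restrict_monomial.rep_eq)

lemma keys_restrict_monomial [simp]: "keys (restrict_monomial V \<alpha>) = keys \<alpha> \<inter> V"
  by (auto simp: in_keys_iff split: if_splits)

lemma restrict_monomial_id: "keys \<alpha> \<subseteq> V \<Longrightarrow> restrict_monomial V \<alpha> = \<alpha>"
  by (rule poly_mapping_eqI) (auto simp: in_keys_iff)

lemma restrict_monomial_eq_0: "keys \<alpha> \<inter> V = {} \<Longrightarrow> restrict_monomial V \<alpha> = 0"
  by (rule poly_mapping_eqI) (auto simp: in_keys_iff)

lemma restrict_monomial_add:
  "restrict_monomial V (\<alpha> + \<beta>) = restrict_monomial V \<alpha> + restrict_monomial V \<beta>"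
  by (rule poly_mapping_eqI) (auto simp: lookup_add)

lemma restrict_monomial_Compl_add:
  "restrict_monomial V \<alpha> + restrict_monomial (- V) \<alpha> = \<alpha>"
  by (rule poly_mapping_eqI) (auto simp: lookup_add)

lemma single_add_restrict_monomial: "single v (lookup \<alpha> v) + restrict_monomial (- {v}) \<alpha> = \<alpha>"
  by (rule poly_mapping_eqI) (auto simp: lookup_add lookup_single when_def)

lemma lookup_map_key: "inj \<tau> \<Longrightarrow> lookup (map_key \<tau> \<alpha>) v = lookup \<alpha> (\<tau> v)"
  by (simp add: map_key.rep_eq)

lemma mdegree_add: "mdegree (\<alpha> + \<beta>) = mdegree \<alpha> + mdegree \<beta>"
  unfolding mdegree_def using setsum_keys_plus_distrib[of "\<lambda>_ x. x" \<alpha> \<beta>] by simp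

lemma sum_mset_exponents: "sum_mset (exponents \<alpha>) = mdegree \<alpha>"
  by (simp add: exponents_def mdegree_def sum_unfold_sum_mset)

lemma size_exponents: "size (exponents \<alpha>) = card (keys \<alpha>)"
  by (simp add: exponents_def)

lemma exponents_in_partitions: "exponents \<alpha> \<in> partitions"
  by (auto simp: partitions_def exponents_def in_keys_iff)

lemma exponents_eq_empty_iff: "exponents \<alpha> = {#} \<longleftrightarrow> keys \<alpha> = {}"
  by (simp add: exponents_def mset_set_empty_iff)

lemma exponents_single_add:
  assumes "k \<noteq> 0" "v \<notin> keys \<alpha>"
  shows "exponents (single v k + \<alpha>) = add_mset k (exponents \<alpha>)"
proof -
  have "lookup \<alpha> v = 0" using assms(2) by (simp add: in_keys_iff)
  then have keys: "keys (single v k + \<alpha>) = insert v (keys \<alpha>)"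
    using assms(1) by (auto simp: in_keys_iff lookup_add lookup_single when_def split: if_splits)
  have "image_mset (lookup (single v k + \<alpha>)) (mset_set (keys \<alpha>))
      = image_mset (lookup \<alpha>) (mset_set (keys \<alpha>))"
    by (rule image_mset_cong) (use assms(2) in \<open>auto simp: lookup_add lookup_single when_def\<close>)
  then show ?thesis
    unfolding exponents_def keys
    using assms(2) \<open>lookup \<alpha> v = 0\<close> by (simp add: lookup_add)
qed

lemma exists_monomial_with_exponents:
  assumes "infinite V" "lam \<in> partitions"
  shows "\<exists>\<alpha>. keys \<alpha> \<subseteq> V \<and> exponents \<alpha> = lam"
  using assms(2)
proof (induction lam)
  case empty
  then show ?case by (intro exI[of _ 0]) (simp add: exponents_def)
next
  case (add k lam)
  then obtain \<alpha> where \<alpha>: "keys \<alpha> \<subseteq> V" "exponents \<alpha> = lam"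
    by (auto simp: partitions_def)
  have "infinite (V - keys \<alpha>)" using assms(1) by simp
  then obtain v where v: "v \<in> V" "v \<notin> keys \<alpha>"
    by (metis Diff_iff finite.emptyI ex_in_conv)
  have "k \<noteq> 0" using add.prems by (auto simp: partitions_def)
  moreover have "keys (single v k + \<alpha>) \<subseteq> V"
    using keys_add[of "single v k" \<alpha>] v \<alpha>(1) by (auto split: if_splits)
  ultimately show ?case using exponents_single_add[of k v \<alpha>] v \<alpha>(2) by metis
qed

lemma finite_partitions_sum_le: "finite {lam \<in> partitions. sum_mset lam \<le> d}"
proof (rule finite_subset)
  show "{lam \<in> partitions. sum_mset lam \<le> d} \<subseteq> mset ` {xs. set xs \<subseteq> {..d} \<and> length xs \<le> d}"
  proof
    fix lam assume lam: "lam \<in> {lam \<in> partitions. sum_mset lam \<le> d}"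
    have "size lam \<le> sum_mset lam" if "0 \<notin># lam"
      using that by (induction lam) auto
    then have "size lam \<le> d" using lam by (auto simp: partitions_def)
    moreover have "k \<le> d" if "k \<in># lam" for k
      using lam sum_mset.remove[OF that] by auto
    moreover obtain xs where "lam = mset xs" by (metis ex_mset)
    ultimately show "lam \<in> mset ` {xs. set xs \<subseteq> {..d} \<and> length xs \<le> d}" by auto
  qed
qed (simp add: finite_lists_length_le)

text \<open>
  Padding both monomials with zero exponents to a common finite set of indeterminates turns
  equality of the exponent multisets into the existence of a permutation of that set.
\<close>

lemma equal_exponents_permutation:
  assumes eq: "exponents (restrict_monomial V \<alpha>) = exponents (restrict_monomial V \<beta>)"
  obtains \<tau> where "\<tau> permutes V" "restrict_monomial V (map_key \<tau> \<alpha>) = restrict_monomial V \<beta>"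
    "restrict_monomial (- V) (map_key \<tau> \<alpha>) = restrict_monomial (- V) \<alpha>"
proof -
  define A where "A = (keys \<alpha> \<union> keys \<beta>) \<inter> V"
  have A: "finite A" "A \<subseteq> V" by (auto simp: A_def)
  have padded: "image_mset (lookup \<gamma>) (mset_set A)
      = exponents (restrict_monomial V \<gamma>)
        + replicate_mset (card A - size (exponents (restrict_monomial V \<gamma>))) 0"
    if \<gamma>: "keys \<gamma> \<inter> V \<subseteq> A" for \<gamma>
  proof -
    let ?K = "keys \<gamma> \<inter> V"
    have "mset_set A = mset_set ?K + mset_set (A - ?K)"
      using mset_set_Union[of ?K "A - ?K"] A \<gamma> by (simp add: Un_absorb1)
    moreover have "image_mset (lookup \<gamma>) (mset_set (A - ?K))
        = image_mset (\<lambda>_. 0) (mset_set (A - ?K))"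
      by (rule image_mset_cong) (use A in \<open>auto simp: in_keys_iff\<close>)
    moreover have "image_mset (lookup \<gamma>) (mset_set ?K) = exponents (restrict_monomial V \<gamma>)"
      unfolding exponents_def keys_restrict_monomial by (rule image_mset_cong) auto
    moreover have "card (A - ?K) = card A - card ?K"
      by (rule card_Diff_subset) (use \<gamma> in auto)
    ultimately show ?thesis by (simp add: size_exponents image_mset_const_eq)
  qed
  have "image_mset (lookup \<beta>) (mset_set A) = image_mset (lookup \<alpha>) (mset_set A)"
  proof -
    have "keys \<alpha> \<inter> V \<subseteq> A" "keys \<beta> \<inter> V \<subseteq> A" by (auto simp: A_def)
    then show ?thesis using padded eq by simp
  qed
  then obtain \<tau> where \<tau>: "\<tau> permutes A" "\<forall>v\<in>A. lookup \<beta> v = lookup \<alpha> (\<tau> v)"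
    using image_mset_eq_implies_permutes[OF A(1)] by metis
  have lookup_\<tau>: "lookup (map_key \<tau> \<alpha>) v = lookup \<alpha> (\<tau> v)" for v
    using \<tau>(1) by (intro lookup_map_key) (rule permutes_inj)
  have "\<tau> permutes V" using \<tau>(1) A(2) by (rule permutes_subset)
  moreover have "lookup \<alpha> (\<tau> v) = lookup \<beta> v" if "v \<in> V" for v
  proof (cases "v \<in> A")
    case False
    then have "\<tau> v = v" using \<tau>(1) by (simp add: permutes_def)
    with False that show ?thesis by (auto simp: A_def in_keys_iff)
  qed (use \<tau>(2) in auto)
  moreover have "\<tau> v = v" if "v \<notin> V" for v
    using that \<tau>(1) A(2) by (auto simp: permutes_def)
  ultimately show thesis
    by (intro that poly_mapping_eqI) (auto simp: lookup_\<tau>)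
qed

lemma restrict_map_key_other:
  assumes "\<tau> permutes W" "V \<inter> W = {}"
  shows "restrict_monomial V (map_key \<tau> \<alpha>) = restrict_monomial V \<alpha>"
proof (rule poly_mapping_eqI)
  fix v
  have "\<tau> v = v" if "v \<in> V" using that assms by (auto simp: permutes_def)
  then show "lookup (restrict_monomial V (map_key \<tau> \<alpha>)) v = lookup (restrict_monomial V \<alpha>) v"
    using lookup_map_key[OF permutes_inj[OF assms(1)]] by auto
qed

lemma exponents_restrict_map_key:
  assumes "\<tau> permutes V"
  shows "exponents (restrict_monomial V (map_key \<tau> \<alpha>)) = exponents (restrict_monomial V \<alpha>)"
proof -
  have inj: "inj \<tau>" using assms by (rule permutes_inj)
  let ?K = "keys (map_key \<tau> \<alpha>) \<inter> V"
  have "x \<in> \<tau> ` ?K" if "x \<in> keys \<alpha> \<inter> V" for x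
  proof -
    obtain v where "x = \<tau> v" using permutes_surj[OF assms] by (metis surjD)
    then show ?thesis using that permutes_in_image[OF assms]
      by (auto simp: keys_map_key[OF inj])
  qed
  then have img: "\<tau> ` ?K = keys \<alpha> \<inter> V"
    using permutes_in_image[OF assms] by (auto simp: keys_map_key[OF inj])
  have "exponents (restrict_monomial V (map_key \<tau> \<alpha>))
      = image_mset (\<lambda>v. lookup \<alpha> (\<tau> v)) (mset_set ?K)"
    unfolding exponents_def keys_restrict_monomial
    by (rule image_mset_cong) (auto simp: lookup_map_key[OF inj])
  also have "\<dots> = image_mset (lookup \<alpha>) (image_mset \<tau> (mset_set ?K))"
    by (simp add: multiset.map_comp comp_def)
  also have "image_mset \<tau> (mset_set ?K) = mset_set (keys \<alpha> \<inter> V)"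
    using image_mset_mset_set[of \<tau> ?K] inj img by (simp add: inj_on_def)
  also have "image_mset (lookup \<alpha>) (mset_set (keys \<alpha> \<inter> V)) = exponents (restrict_monomial V \<alpha>)"
    unfolding exponents_def keys_restrict_monomial by (rule image_mset_cong) auto
  finally show ?thesis .
qed


section \<open>Products of symmetric functions\<close>

text \<open>
  A monomial is in only one way a product of a monomial in \<open>X\<close> and one in the complement, so the
  convolution has a single term.
\<close>

lemma mcoeff_times_Compl:
  assumes f: "\<And>\<alpha>. mcoeff f \<alpha> \<noteq> 0 \<Longrightarrow> keys \<alpha> \<subseteq> X"
    and g: "\<And>\<alpha>. mcoeff g \<alpha> \<noteq> 0 \<Longrightarrow> keys \<alpha> \<subseteq> - X"
  shows "mcoeff (f * g :: ('v, rat) mfps) \<alpha>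
    = mcoeff f (restrict_monomial X \<alpha>) * mcoeff g (restrict_monomial (- X) \<alpha>)"
proof -
  let ?p = "(restrict_monomial X \<alpha>, restrict_monomial (- X) \<alpha>)"
  have zero: "mcoeff f \<beta> * mcoeff g \<gamma> = 0" if "\<beta> + \<gamma> = \<alpha>" "(\<beta>, \<gamma>) \<noteq> ?p" for \<beta> \<gamma>
  proof (rule ccontr)
    assume "mcoeff f \<beta> * mcoeff g \<gamma> \<noteq> 0"
    then have "keys \<beta> \<subseteq> X" "keys \<gamma> \<subseteq> - X" using f g by auto
    moreover from this have "keys \<beta> \<inter> - X = {}" "keys \<gamma> \<inter> X = {}" by auto
    ultimately have "(\<beta>, \<gamma>) = ?p"
      unfolding that(1)[symmetric]
      by (simp add: restrict_monomial_add restrict_monomial_id restrict_monomial_eq_0)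
    then show False using that(2) by simp
  qed
  have "mcoeff (f * g) \<alpha> = (\<Sum>(\<beta>, \<gamma>)\<in>{?p}. mcoeff f \<beta> * mcoeff g \<gamma>)"
    unfolding mcoeff_times
  proof (intro sum.mono_neutral_right finite_monomial_splittings ballI)
    fix q assume "q \<in> {(\<beta>, \<gamma>). \<beta> + \<gamma> = \<alpha>} - {?p}"
    then show "(case q of (\<beta>, \<gamma>) \<Rightarrow> mcoeff f \<beta> * mcoeff g \<gamma>) = 0"
      using zero[of "fst q" "snd q"] by (simp add: split_def)
  qed (simp add: restrict_monomial_Compl_add)
  then show ?thesis by simp
qed

text \<open>
  A bijective substitution of indeterminates maps the factorisations of \<open>\<alpha>\<close> bijectively to those
  of its image.
\<close>

lemma mcoeff_times_map_key:
  assumes \<tau>: "bij \<tau>"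
    and f: "\<And>\<alpha>. mcoeff f (map_key \<tau> \<alpha>) = mcoeff f \<alpha>"
    and g: "\<And>\<alpha>. mcoeff g (map_key \<tau> \<alpha>) = mcoeff g \<alpha>"
  shows "mcoeff (f * g) (map_key \<tau> \<alpha>) = mcoeff (f * g) \<alpha>"
proof -
  have inj: "inj \<tau>" "inj (inv \<tau>)"
    using \<tau> by (auto simp: bij_is_inj bij_imp_bij_inv)
  have inverse: "map_key \<tau> (map_key (inv \<tau>) \<beta>) = \<beta>" "map_key (inv \<tau>) (map_key \<tau> \<beta>) = \<beta>" for \<beta>
    using \<tau> by (auto intro!: poly_mapping_eqI
        simp: lookup_map_key inj bij_inv_eq_iff[symmetric] surj_f_inv_f bij_is_surj)
  show ?thesis
    unfolding mcoeff_times
    by (rule sum.reindex_bij_witness[where i = "\<lambda>(\<beta>, \<gamma>). (map_key \<tau> \<beta>, map_key \<tau> \<gamma>)"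
          and j = "\<lambda>(\<beta>, \<gamma>). (map_key (inv \<tau>) \<beta>, map_key (inv \<tau>) \<gamma>)"])
      (auto simp: inverse map_key_plus[OF inj(1), symmetric] map_key_plus[OF inj(2), symmetric]
        simp flip: f[of "map_key (inv \<tau>) _"] g[of "map_key (inv \<tau>) _"])
qed

lemma one_in_symmetric_functions: "1 \<in> symmetric_functions \<V>"
proof -
  have "map_key \<tau> \<alpha> = 0 \<longleftrightarrow> \<alpha> = 0" if "\<tau> permutes V" for \<tau> V and \<alpha> :: "'v monomial"
  proof -
    have inj: "inj \<tau>" and surj: "surj \<tau>"
      using permutes_inj[OF that] permutes_surj[OF that] .
    show ?thesis
      using surj_vimage_empty[OF surj, of "keys \<alpha>"]
      by (metis keys_eq_empty keys_map_key[OF inj])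
  qed
  then show ?thesis
    by (auto simp: symmetric_functions_def bounded_degree_def mcoeff_one intro!: exI[of _ 0]
        split: if_splits simp: mdegree_def)
qed

lemma times_in_symmetric_functions:
  assumes f: "f \<in> symmetric_functions \<V>" and g: "g \<in> symmetric_functions \<V>"
  shows "f * g \<in> symmetric_functions \<V>"
proof -
  obtain d e where d: "\<And>\<alpha>. mcoeff f \<alpha> \<noteq> 0 \<Longrightarrow> mdegree \<alpha> \<le> d"
    and e: "\<And>\<alpha>. mcoeff g \<alpha> \<noteq> 0 \<Longrightarrow> mdegree \<alpha> \<le> e"
    using f g by (auto simp: symmetric_functions_def bounded_degree_def)
  have "mdegree \<alpha> \<le> d + e" if "mcoeff (f * g) \<alpha> \<noteq> 0" for \<alpha>
    using that by (rule mcoeff_times_nonzeroE) (auto simp: mdegree_add d e add_mono)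
  then have "bounded_degree (f * g)" by (auto simp: bounded_degree_def)
  moreover have "keys \<alpha> \<subseteq> \<Union>\<V>" if nz: "mcoeff (f * g) \<alpha> \<noteq> 0" for \<alpha>
  proof -
    obtain \<beta> \<gamma> where "\<alpha> = \<beta> + \<gamma>" "mcoeff f \<beta> \<noteq> 0" "mcoeff g \<gamma> \<noteq> 0"
      using nz by (rule mcoeff_times_nonzeroE)
    moreover from this have "keys \<beta> \<subseteq> \<Union>\<V>" "keys \<gamma> \<subseteq> \<Union>\<V>"
      using f g by (simp_all add: symmetric_functions_def)
    ultimately show ?thesis using keys_add[of \<beta> \<gamma>] by blast
  qed
  moreover have "mcoeff (f * g) (map_key \<tau> \<alpha>) = mcoeff (f * g) \<alpha>"
    if "V \<in> \<V>" "\<tau> permutes V" for V \<tau> \<alpha>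
    by (rule mcoeff_times_map_key)
      (use f g that in \<open>auto simp: symmetric_functions_def permutes_bij\<close>)
  ultimately show ?thesis by (simp add: symmetric_functions_def)
qed

lemma power_sum_in_symmetric_functions:
  assumes "k \<noteq> 0"
  shows "power_sum V k \<in> symmetric_functions {V}"
proof -
  have "(\<exists>v\<in>V. map_key \<tau> \<alpha> = single v k) \<longleftrightarrow> (\<exists>v\<in>V. \<alpha> = single v k)"
    if \<tau>: "\<tau> permutes V" for \<tau> \<alpha>
  proof -
    have inj: "inj \<tau>" using \<tau> by (rule permutes_inj)
    have key: "map_key \<tau> \<alpha> = single v k \<longleftrightarrow> \<alpha> = single (\<tau> v) k" for v
    proof
      assume L: "map_key \<tau> \<alpha> = single v k"
      show "\<alpha> = single (\<tau> v) k"
      proof (rule poly_mapping_eqI)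
        fix x
        obtain w where x: "x = \<tau> w" using permutes_surj[OF \<tau>] by (metis surjD)
        have "lookup \<alpha> (\<tau> w) = lookup (single v k) w"
          using L lookup_map_key[OF inj, of \<alpha> w] by simp
        then show "lookup \<alpha> x = lookup (single (\<tau> v) k) x"
          using inj by (simp add: x lookup_single when_def inj_eq)
      qed
    qed (simp add: map_key_single[OF inj])
    show ?thesis
    proof
      assume "\<exists>v\<in>V. \<alpha> = single v k"
      then obtain v where v: "v \<in> V" "\<alpha> = single v k" by auto
      then have "v = \<tau> (inv \<tau> v)" "inv \<tau> v \<in> V"
        using \<tau> by (auto simp: permutes_inverses permutes_in_image permutes_inv)
      then show "\<exists>v\<in>V. map_key \<tau> \<alpha> = single v k" using key v by metis
    qed (use key permutes_in_image[OF \<tau>] in auto)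
  qed
  then show ?thesis
    using assms
    by (auto simp: symmetric_functions_def bounded_degree_def power_sum_def mdegree_def
        intro!: exI[of _ k] split: if_splits)
qed

lemma power_sum_sym_in_symmetric_functions:
  "mu \<in> partitions \<Longrightarrow> power_sum_sym V mu \<in> symmetric_functions {V}"
  by (induction mu) (auto simp: power_sum_sym_def partitions_def one_in_symmetric_functions
      times_in_symmetric_functions power_sum_in_symmetric_functions)

lemma subspace_symmetric_functions: "mfps.subspace (symmetric_functions \<V>)"
proof -
  have bounded_add: "bounded_degree (f + g)" if bd: "bounded_degree f" "bounded_degree g" for f g :: "('v, rat) mfps"
  proof -
    obtain d e where "\<And>\<alpha>. mcoeff f \<alpha> \<noteq> 0 \<Longrightarrow> mdegree \<alpha> \<le> d" "\<And>\<alpha>. mcoeff g \<alpha> \<noteq> 0 \<Longrightarrow> mdegree \<alpha> \<le> e"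
      using bd by (auto simp: bounded_degree_def)
    then have "mdegree \<alpha> \<le> max d e" if "mcoeff (f + g) \<alpha> \<noteq> 0" for \<alpha>
      using that by (metis add.right_neutral max.coboundedI1 max.coboundedI2 mcoeff_simps(2))
    then show ?thesis by (auto simp: bounded_degree_def)
  qed
  have keys_plus: "keys \<alpha> \<subseteq> \<Union>\<V>"
    if "f \<in> symmetric_functions \<V>" "g \<in> symmetric_functions \<V>" "mcoeff f \<alpha> + mcoeff g \<alpha> \<noteq> 0" for f g \<alpha>
  proof (cases "mcoeff f \<alpha> = 0")
    case True
    then have "mcoeff g \<alpha> \<noteq> 0" using that by simp
    then show ?thesis using that by (simp add: symmetric_functions_def)
  qed (use that in \<open>simp add: symmetric_functions_def\<close>)
  have add: "f + g \<in> symmetric_functions \<V>"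
    if "f \<in> symmetric_functions \<V>" "g \<in> symmetric_functions \<V>" for f g
  proof -
    have "bounded_degree (f + g)"
      using that by (intro bounded_add) (simp_all add: symmetric_functions_def)
    moreover have "\<forall>\<alpha>. mcoeff (f + g) \<alpha> \<noteq> 0 \<longrightarrow> keys \<alpha> \<subseteq> \<Union>\<V>"
      using keys_plus[OF that] by simp
    ultimately show ?thesis
      using that unfolding symmetric_functions_def by simp
  qed
  have "mscale c f \<in> symmetric_functions \<V>" if "f \<in> symmetric_functions \<V>" for c f
  proof -
    have "mcoeff f \<alpha> \<noteq> 0" if "mcoeff (mscale c f) \<alpha> \<noteq> 0" for \<alpha> using that by simp
    moreover obtain d where "\<And>\<alpha>. mcoeff f \<alpha> \<noteq> 0 \<Longrightarrow> mdegree \<alpha> \<le> d"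
      using \<open>f \<in> symmetric_functions \<V>\<close> by (auto simp: symmetric_functions_def bounded_degree_def)
    ultimately have "bounded_degree (mscale c f)" unfolding bounded_degree_def by blast
    then show ?thesis using that by (simp add: symmetric_functions_def)
  qed
  moreover have "0 \<in> symmetric_functions \<V>"
    by (simp add: symmetric_functions_def bounded_degree_def)
  ultimately show ?thesis using add by (intro mfps.subspaceI)
qed


section \<open>Bases of the rings of symmetric functions\<close>

text \<open>
  When there are only two sets of indeterminates, the second is the complement of the first, so
  that one parameter describes both.  The class sums are then \<open>m\<^sub>\<lambda>(x) m\<^sub>\<mu>(y)\<close>, and the pairs
  with \<open>\<mu> = \<emptyset>\<close> give the monomial symmetric functions in \<open>x\<close> alone.
\<close>

definition bitype :: "'v set \<Rightarrow> 'v monomial \<Rightarrow> nat multiset \<times> nat multiset" where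
  "bitype X \<alpha> = (exponents (restrict_monomial X \<alpha>), exponents (restrict_monomial (- X) \<alpha>))"

lemma bitype_in_partitions: "bitype X \<alpha> \<in> partitions \<times> partitions"
  by (simp add: bitype_def exponents_in_partitions)

lemma bitype_eq_empty_right_iff: "bitype X \<alpha> = (lam, {#}) \<longleftrightarrow> keys \<alpha> \<subseteq> X \<and> exponents \<alpha> = lam"
proof -
  have "exponents (restrict_monomial (- X) \<alpha>) = {#} \<longleftrightarrow> keys \<alpha> \<subseteq> X"
    unfolding exponents_eq_empty_iff keys_restrict_monomial by auto
  then show ?thesis by (auto simp: bitype_def restrict_monomial_id)
qed

lemma exists_monomial_with_bitype:
  assumes "infinite X" "infinite (- X)" "lam \<in> partitions" "mu \<in> partitions"
  shows "\<exists>\<alpha>. bitype X \<alpha> = (lam, mu)"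
proof -
  obtain \<alpha> \<beta> where \<alpha>: "keys \<alpha> \<subseteq> X" "exponents \<alpha> = lam" and \<beta>: "keys \<beta> \<subseteq> - X" "exponents \<beta> = mu"
    using assms exists_monomial_with_exponents by metis
  have "keys \<alpha> \<inter> - X = {}" "keys \<beta> \<inter> X = {}" using \<alpha> \<beta> by auto
  then have "bitype X (\<alpha> + \<beta>) = (lam, mu)"
    using \<alpha> \<beta>
    by (simp add: bitype_def restrict_monomial_add restrict_monomial_id restrict_monomial_eq_0)
  then show ?thesis by blast
qed

lemma mdegree_eq_bitype: "bitype X \<alpha> = (lam, mu) \<Longrightarrow> mdegree \<alpha> = sum_mset lam + sum_mset mu"
  using mdegree_add[of "restrict_monomial X \<alpha>" "restrict_monomial (- X) \<alpha>"]
  by (auto simp: bitype_def restrict_monomial_Compl_add sum_mset_exponents)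

lemma bitype_map_key:
  assumes "\<tau> permutes V" "V = X \<or> V = - X"
  shows "bitype X (map_key \<tau> \<alpha>) = bitype X \<alpha>"
proof (cases "V = X")
  case True
  then show ?thesis
    using assms(1) exponents_restrict_map_key restrict_map_key_other[of \<tau> X "- X"]
    by (simp add: bitype_def)
next
  case False
  then have "\<tau> permutes - X" using assms by simp
  then show ?thesis
    using exponents_restrict_map_key restrict_map_key_other[of \<tau> "- X" X]
    by (simp add: bitype_def)
qed

lemma symmetric_coeff_eq:
  assumes inv: "\<And>\<tau> \<alpha>. \<tau> permutes V \<Longrightarrow> mcoeff f (map_key \<tau> \<alpha>) = mcoeff f \<alpha>"
    and "exponents (restrict_monomial V \<alpha>) = exponents (restrict_monomial V \<beta>)"
    and other: "restrict_monomial (- V) \<alpha> = restrict_monomial (- V) \<beta>"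
  shows "mcoeff f \<alpha> = mcoeff f \<beta>"
proof -
  obtain \<tau> where \<tau>: "\<tau> permutes V"
    and "restrict_monomial V (map_key \<tau> \<alpha>) = restrict_monomial V \<beta>"
    and "restrict_monomial (- V) (map_key \<tau> \<alpha>) = restrict_monomial (- V) \<alpha>"
    using assms(2) by (rule equal_exponents_permutation)
  then have "map_key \<tau> \<alpha> = \<beta>"
    using other restrict_monomial_Compl_add by metis
  then show ?thesis using inv[OF \<tau>] by metis
qed

lemma symmetric_coeff_eq_bitype:
  assumes f: "f \<in> symmetric_functions {X, - X}" and eq: "bitype X \<alpha> = bitype X \<beta>"
  shows "mcoeff f \<alpha> = mcoeff f \<beta>"
proof -
  \<comment> \<open>Move the \<open>X\<close>-part first and the complementary part afterwards.\<close>
  define \<gamma> where "\<gamma> = restrict_monomial X \<beta> + restrict_monomial (- X) \<alpha>"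
  have \<gamma>: "restrict_monomial X \<gamma> = restrict_monomial X \<beta>"
    "restrict_monomial (- X) \<gamma> = restrict_monomial (- X) \<alpha>"
    by (rule poly_mapping_eqI; simp add: \<gamma>_def lookup_add)+
  have inv: "mcoeff f (map_key \<tau> \<delta>) = mcoeff f \<delta>" if "\<tau> permutes X \<or> \<tau> permutes - X" for \<tau> \<delta>
    using f that by (auto simp: symmetric_functions_def)
  have "mcoeff f \<alpha> = mcoeff f \<gamma>"
    by (rule symmetric_coeff_eq[of X]) (use eq inv in \<open>auto simp: \<gamma> bitype_def\<close>)
  also have "\<dots> = mcoeff f \<beta>"
    by (rule symmetric_coeff_eq[of "- X"]) (use eq inv in \<open>auto simp: \<gamma> bitype_def\<close>)
  finally show ?thesis .
qed

text \<open>
  Bounded degree leaves finitely many pairs of partitions as types of the monomials of \<open>f\<close>.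
\<close>

lemma in_span_bitype_class_sums:
  assumes f: "f \<in> symmetric_functions {X, - X}"
    and J: "\<And>\<alpha>. mcoeff f \<alpha> \<noteq> 0 \<Longrightarrow> bitype X \<alpha> \<in> J"
  shows "f \<in> mfps.span (class_sum (bitype X) ` J)"
proof (rule in_span_class_sum)
  obtain d where d: "\<And>\<alpha>. mcoeff f \<alpha> \<noteq> 0 \<Longrightarrow> mdegree \<alpha> \<le> d"
    using f by (auto simp: symmetric_functions_def bounded_degree_def)
  let ?P = "{lam \<in> partitions. sum_mset lam \<le> d}"
  have "bitype X \<alpha> \<in> ?P \<times> ?P" if "mcoeff f \<alpha> \<noteq> 0" for \<alpha>
  proof (cases "bitype X \<alpha>")
    case (Pair lam mu)
    then show ?thesis
      using d[OF that] mdegree_eq_bitype[OF Pair] bitype_in_partitions[of X \<alpha>] by auto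
  qed
  then have "{bitype X \<alpha> | \<alpha>. mcoeff f \<alpha> \<noteq> 0} \<subseteq> ?P \<times> ?P" by blast
  then show "finite {bitype X \<alpha> | \<alpha>. mcoeff f \<alpha> \<noteq> 0}"
    by (rule finite_subset) (intro finite_cartesian_product finite_partitions_sum_le)
qed (use assms symmetric_coeff_eq_bitype in auto)

text \<open>
  Permuting indeterminates that do not occur changes nothing.  With this, the functions of one
  set of variables share their expansions with those of two sets.
\<close>

lemma symmetric_functions_subset: "symmetric_functions {X} \<subseteq> symmetric_functions {X, - X}"
proof
  fix f assume f: "f \<in> symmetric_functions {X}"
  have "mcoeff f (map_key \<tau> \<alpha>) = mcoeff f \<alpha>" if \<tau>: "\<tau> permutes - X" for \<tau> \<alpha>
  proof (cases "keys \<alpha> \<subseteq> X")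
    case True
    then have "keys (map_key \<tau> \<alpha>) \<subseteq> X"
      using bitype_map_key[OF \<tau>, of X \<alpha>] bitype_eq_empty_right_iff by metis
    then have "map_key \<tau> \<alpha> = \<alpha>"
      using True restrict_map_key_other[OF \<tau>, of X \<alpha>] by (simp add: restrict_monomial_id)
    then show ?thesis by simp
  next
    case False
    then have "\<not> keys (map_key \<tau> \<alpha>) \<subseteq> X"
      using bitype_map_key[OF \<tau>, of X \<alpha>] bitype_eq_empty_right_iff by metis
    then have "mcoeff f (map_key \<tau> \<alpha>) = 0" "mcoeff f \<alpha> = 0"
      using f False by (auto simp: symmetric_functions_def)
    then show ?thesis by simp
  qed
  then show "f \<in> symmetric_functions {X, - X}"
    using f by (auto simp: symmetric_functions_def)
qed

lemma class_sum_in_symmetric_functions: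
  "class_sum (bitype X) (lam, mu) \<in> symmetric_functions {X, - X}"
proof -
  have "bounded_degree (class_sum (bitype X) (lam, mu))"
    unfolding bounded_degree_def class_sum_def
    by (rule exI[of _ "sum_mset lam + sum_mset mu"]) (auto simp: mdegree_eq_bitype)
  then show ?thesis
    by (auto simp: symmetric_functions_def class_sum_def bitype_map_key)
qed

lemma class_sum_eq_monomial_sym: "class_sum (bitype X) (lam, {#}) = monomial_sym X lam"
  by (simp add: class_sum_def monomial_sym_def bitype_eq_empty_right_iff)

lemma monomial_sym_in_symmetric_functions: "monomial_sym X lam \<in> symmetric_functions {X}"
  using class_sum_in_symmetric_functions[of X lam "{#}"]
  unfolding class_sum_eq_monomial_sym
  by (auto simp: symmetric_functions_def monomial_sym_def split: if_splits)

lemma bitype_class_sums_independent: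
  assumes "infinite X" "infinite (- X)" "J \<subseteq> partitions \<times> partitions"
  shows "inj_on (class_sum (bitype X)) J \<and> mfps.independent (class_sum (bitype X) ` J)"
proof (rule class_sum_independent, rule subsetI)
  fix p assume "p \<in> J"
  then have "\<exists>\<alpha>. bitype X \<alpha> = p"
    using assms exists_monomial_with_bitype[of X "fst p" "snd p"] by auto
  then show "p \<in> range (bitype X)" by blast
qed

lemma class_sum_basis2:
  assumes "infinite X" "infinite (- X)"
  shows "is_linear_basis (class_sum (bitype X)) (partitions \<times> partitions)
    (symmetric_functions {X, - X})"
proof -
  let ?J = "partitions \<times> partitions"
  have "class_sum (bitype X) ` ?J \<subseteq> symmetric_functions {X, - X}"
    using class_sum_in_symmetric_functions by auto
  then have "mfps.span (class_sum (bitype X) ` ?J) \<subseteq> symmetric_functions {X, - X}"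
    by (intro mfps.span_minimal subspace_symmetric_functions)
  moreover have "symmetric_functions {X, - X} \<subseteq> mfps.span (class_sum (bitype X) ` ?J)"
    using in_span_bitype_class_sums bitype_in_partitions by blast
  ultimately show ?thesis
    using bitype_class_sums_independent[OF assms] by (simp add: is_linear_basis_def)
qed

lemma class_sum_basis1:
  assumes "infinite X" "infinite (- X)"
  shows "is_linear_basis (class_sum (bitype X)) (partitions \<times> {{#}}) (symmetric_functions {X})"
proof -
  let ?J = "partitions \<times> {{#}}"
  have "class_sum (bitype X) ` ?J \<subseteq> symmetric_functions {X}"
    by (auto simp: class_sum_eq_monomial_sym monomial_sym_in_symmetric_functions)
  then have "mfps.span (class_sum (bitype X) ` ?J) \<subseteq> symmetric_functions {X}"
    by (intro mfps.span_minimal subspace_symmetric_functions)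
  moreover have "f \<in> mfps.span (class_sum (bitype X) ` ?J)" if f: "f \<in> symmetric_functions {X}" for f
  proof (rule in_span_bitype_class_sums)
    fix \<alpha> assume "mcoeff f \<alpha> \<noteq> 0"
    then have "bitype X \<alpha> = (exponents \<alpha>, {#})"
      unfolding bitype_eq_empty_right_iff using f by (auto simp: symmetric_functions_def)
    then show "bitype X \<alpha> \<in> ?J" by (simp add: exponents_in_partitions)
  qed (use f symmetric_functions_subset in auto)
  moreover have "?J \<subseteq> partitions \<times> partitions" by (auto simp: partitions_def)
  ultimately show ?thesis
    using bitype_class_sums_independent[OF assms] by (auto simp: is_linear_basis_def)
qed

text \<open>
  Multiplying by \<open>p\<^sub>k\<close> adds \<open>k\<close> to one exponent: if that exponent was zero, \<open>k\<close> becomes a new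
  part; otherwise the number of parts stays the same, which is less than required.  All terms
  have nonnegative coefficients, so the expected ones survive.
\<close>

lemma power_sum_sym_leading_term:
  assumes "mu \<in> partitions"
  shows "0 \<le> mcoeff (power_sum_sym V mu) \<alpha>"
    and "mcoeff (power_sum_sym V mu) \<alpha> \<noteq> 0 \<Longrightarrow> exponents \<alpha> = mu \<or> size (exponents \<alpha>) < size mu"
    and "keys \<alpha> \<subseteq> V \<Longrightarrow> exponents \<alpha> = mu \<Longrightarrow> 0 < mcoeff (power_sum_sym V mu) \<alpha>"
  using assms
proof (induction mu arbitrary: \<alpha>)
  case empty
  {
    case 1
    then show ?case by (simp add: power_sum_sym_def mcoeff_one)
  next
    case 2
    then show ?case by (simp add: power_sum_sym_def mcoeff_one exponents_def split: if_splits)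
  next
    case 3
    then show ?case by (simp add: power_sum_sym_def mcoeff_one exponents_eq_empty_iff)
  }
next
  case (add k mu)
  let ?p = "power_sum V k" and ?f = "power_sum_sym V mu"
  have prod: "power_sum_sym V (add_mset k mu) = ?p * ?f"
    by (simp add: power_sum_sym_def)
  have mu: "mu \<in> partitions" and k: "k \<noteq> 0" if "add_mset k mu \<in> partitions"
    using that by (auto simp: partitions_def)
  have p: "mcoeff ?p \<beta> = (if \<exists>v\<in>V. \<beta> = single v k then 1 else 0)" for \<beta>
    by (simp add: power_sum_def)
  {
    case 1
    show ?case
      unfolding prod mcoeff_times
      by (intro sum_nonneg) (auto simp: p add.IH(1)[OF mu[OF 1]])
  next
    case 2
    obtain \<beta> \<gamma> where \<alpha>: "\<alpha> = \<beta> + \<gamma>" and "mcoeff ?p \<beta> \<noteq> 0" and \<gamma>: "mcoeff ?f \<gamma> \<noteq> 0"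
      using 2(1) unfolding prod by (rule mcoeff_times_nonzeroE)
    then obtain v where v: "\<beta> = single v k" by (auto simp: p split: if_splits)
    note IH = add.IH(2)[OF \<gamma> mu[OF 2(2)]]
    show ?case
    proof (cases "v \<in> keys \<gamma>")
      case True
      then have "keys \<alpha> \<subseteq> keys \<gamma>"
        using keys_add[of \<beta> \<gamma>] by (auto simp: \<alpha> v split: if_splits)
      then have "size (exponents \<alpha>) \<le> size (exponents \<gamma>)"
        unfolding size_exponents by (intro card_mono) auto
      then show ?thesis using IH by auto
    next
      case False
      then have "exponents \<alpha> = add_mset k (exponents \<gamma>)"
        unfolding \<alpha> v using k[OF 2(2)] by (intro exponents_single_add)
      then show ?thesis using IH by auto
    qed
  next
    case 3
    have "k \<in># exponents \<alpha>" using 3(2) by simp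
    then obtain v where v: "v \<in> keys \<alpha>" "lookup \<alpha> v = k"
      by (auto simp: exponents_def)
    define \<gamma> where "\<gamma> = restrict_monomial (- {v}) \<alpha>"
    have \<alpha>: "single v k + \<gamma> = \<alpha>"
      using single_add_restrict_monomial[of v \<alpha>] v(2) by (simp add: \<gamma>_def)
    have "v \<notin> keys \<gamma>" by (simp add: \<gamma>_def)
    then have "exponents \<alpha> = add_mset k (exponents \<gamma>)"
      unfolding \<alpha>[symmetric] using k[OF 3(3)] by (intro exponents_single_add)
    then have "exponents \<gamma> = mu" using 3(2) by simp
    moreover have "keys \<gamma> \<subseteq> V" using 3(1) by (auto simp: \<gamma>_def)
    ultimately have "0 < mcoeff ?f \<gamma>" using add.IH(3) mu[OF 3(3)] by blast
    also have "mcoeff ?f \<gamma> = (case (single v k, \<gamma>) of (\<beta>, \<gamma>) \<Rightarrow> mcoeff ?p \<beta> * mcoeff ?f \<gamma>)"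
      using v(1) 3(1) by (auto simp: p)
    also have "\<dots> \<le> mcoeff (?p * ?f) \<alpha>"
      unfolding mcoeff_times
      by (rule member_le_sum)
        (use \<alpha> in \<open>auto simp: p add.IH(1)[OF mu[OF 3(3)]] finite_monomial_splittings\<close>)
    finally show ?case unfolding prod .
  }
qed

definition mixed_product :: "'v set \<Rightarrow> nat multiset \<times> nat multiset \<Rightarrow> ('v, rat) mfps" where
  "mixed_product X = (\<lambda>(lam, mu). monomial_sym X lam * power_sum_sym (- X) mu)"

text \<open>
  The coefficient of \<open>m\<^sub>\<lambda>(x) p\<^sub>\<mu>(y)\<close> at a monomial whose \<open>x\<close>-part has exponents \<open>\<lambda>\<close> is the
  coefficient of \<open>p\<^sub>\<mu>\<close> at its \<open>y\<close>-part, so the triangular shape is that of \<open>p\<^sub>\<mu>\<close>.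
\<close>

lemma mixed_product_triangular:
  assumes inf: "infinite (- X)" and mu: "mu \<in> partitions"
  shows "\<exists>a. a \<noteq> 0 \<and> mixed_product X (lam, mu) - mscale a (class_sum (bitype X) (lam, mu))
    \<in> mfps.span (class_sum (bitype X) ` {(lam, nu) | nu. nu \<in> partitions \<and> size nu < size mu})"
proof -
  let ?p = "power_sum_sym (- X) mu" and ?c = "class_sum (bitype X) (lam, mu)"
  let ?N = "mixed_product X (lam, mu)"
  have p: "?p \<in> symmetric_functions {- X}"
    using mu by (rule power_sum_sym_in_symmetric_functions)
  have p2: "?p \<in> symmetric_functions {X, - X}"
    using p symmetric_functions_subset[of "- X"] by (auto simp: insert_commute)
  have m2: "monomial_sym X lam \<in> symmetric_functions {X, - X}"
    using monomial_sym_in_symmetric_functions symmetric_functions_subset by blast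
  have N: "?N \<in> symmetric_functions {X, - X}"
    using times_in_symmetric_functions[OF m2 p2] by (simp add: mixed_product_def)
  have coeff: "mcoeff ?N \<alpha> = (if exponents (restrict_monomial X \<alpha>) = lam then 1 else 0)
      * mcoeff ?p (restrict_monomial (- X) \<alpha>)" for \<alpha>
    unfolding mixed_product_def prod.case
    by (subst mcoeff_times_Compl[of _ X])
      (use p in \<open>auto simp: monomial_sym_def symmetric_functions_def split: if_splits\<close>)
  \<comment> \<open>By symmetry the leading coefficient can be read off at any monomial with exponents \<open>\<mu>\<close>.\<close>
  obtain \<delta> where \<delta>: "keys \<delta> \<subseteq> - X" "exponents \<delta> = mu"
    using exists_monomial_with_exponents[OF inf mu] by blast
  define a where "a = mcoeff ?p \<delta>"
  have "a \<noteq> 0"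
    using power_sum_sym_leading_term(3)[OF mu \<delta>] by (simp add: a_def)
  have lead: "mcoeff ?p (restrict_monomial (- X) \<alpha>) = a"
    if "exponents (restrict_monomial (- X) \<alpha>) = mu" for \<alpha>
    unfolding a_def
  proof (rule symmetric_coeff_eq_bitype[OF p2])
    have "keys \<delta> \<inter> X = {}" using \<delta> by auto
    then show "bitype X (restrict_monomial (- X) \<alpha>) = bitype X \<delta>"
      using that \<delta> by (auto simp: bitype_def restrict_monomial_id restrict_monomial_eq_0)
  qed
  have "?N - mscale a ?c \<in> symmetric_functions {X, - X}"
    by (intro mfps.subspace_diff mfps.subspace_scale subspace_symmetric_functions N
        class_sum_in_symmetric_functions)
  then have "?N - mscale a ?c \<in> mfps.span (class_sum (bitype X) `
      {(lam, nu) | nu. nu \<in> partitions \<and> size nu < size mu})"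
  proof (rule in_span_bitype_class_sums)
    fix \<alpha> assume nz: "mcoeff (?N - mscale a ?c) \<alpha> \<noteq> 0"
    let ?nu = "exponents (restrict_monomial (- X) \<alpha>)"
    have lam: "exponents (restrict_monomial X \<alpha>) = lam"
      using nz by (auto simp: coeff class_sum_def bitype_def split: if_splits)
    have nu: "?nu \<noteq> mu"
      using nz lead[of \<alpha>] lam by (auto simp: coeff class_sum_def bitype_def)
    then have "mcoeff ?p (restrict_monomial (- X) \<alpha>) \<noteq> 0"
      using nz by (auto simp: coeff class_sum_def bitype_def)
    then have "size ?nu < size mu"
      using power_sum_sym_leading_term(2)[OF mu] nu by blast
    then show "bitype X \<alpha> \<in> {(lam, nu) | nu. nu \<in> partitions \<and> size nu < size mu}"
      using lam by (simp add: bitype_def exponents_in_partitions)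
  qed
  with \<open>a \<noteq> 0\<close> show ?thesis by blast
qed

lemma mixed_product_basis2:
  assumes "infinite X" "infinite (- X)"
  shows "is_linear_basis (mixed_product X) (partitions \<times> partitions) (symmetric_functions {X, - X})"
proof (rule triangular_is_linear_basis[where rank = "size \<circ> snd", OF class_sum_basis2[OF assms]])
  fix i :: "nat multiset \<times> nat multiset"
  assume "i \<in> partitions \<times> partitions"
  then obtain lam mu where i: "i = (lam, mu)" "lam \<in> partitions" "mu \<in> partitions" by auto
  let ?L = "{(lam, nu) | nu. nu \<in> partitions \<and> size nu < size mu}"
  let ?R = "{j \<in> partitions \<times> partitions. (size \<circ> snd) j < (size \<circ> snd) i}"
  have "?L \<subseteq> ?R" using i by auto
  then have "mfps.span (class_sum (bitype X) ` ?L) \<subseteq> mfps.span (class_sum (bitype X) ` ?R)"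
    by (intro mfps.span_mono image_mono)
  then show "\<exists>a. a \<noteq> 0 \<and> mixed_product X i - mscale a (class_sum (bitype X) i)
      \<in> mfps.span (class_sum (bitype X) ` ?R)"
    using mixed_product_triangular[OF assms(2) i(3), of lam] unfolding i(1) by blast
qed

lemma mixed_product_basis1:
  assumes "infinite X" "infinite (- X)"
  shows "is_linear_basis (mixed_product X) (partitions \<times> {{#}}) (symmetric_functions {X})"
proof -
  have eq: "mixed_product X i = class_sum (bitype X) i" if "i \<in> partitions \<times> {{#}}" for i
    using that by (auto simp: mixed_product_def class_sum_eq_monomial_sym power_sum_sym_def)
  have "mixed_product X ` (partitions \<times> {{#}}) = class_sum (bitype X) ` (partitions \<times> {{#}})"
    by (rule image_cong[OF refl eq])
  moreover have "inj_on (mixed_product X) (partitions \<times> {{#}})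
      \<longleftrightarrow> inj_on (class_sum (bitype X)) (partitions \<times> {{#}})"
    by (rule inj_on_cong[OF eq])
  ultimately show ?thesis
    using class_sum_basis1[OF assms] by (simp add: is_linear_basis_def)
qed


section \<open>Path-cycle covers\<close>

text \<open>
  The relation is an equivalence on the whole type, being reflexive outside the vertex set as
  well; its classes of vertices stay within the vertex set (\<open>Union_components\<close>).
\<close>

lemma equiv_weakly_connected: "equiv UNIV ((S \<union> S\<inverse>)\<^sup>*)"
  by (intro equivI refl_rtrancl trans_rtrancl sym_rtrancl) (auto simp: sym_def)

lemma Union_components:
  assumes "S \<subseteq> V \<times> V"
  shows "\<Union> (components V S) = V"
proof -
  have "y \<in> V" if "(x, y) \<in> (S \<union> S\<inverse>)\<^sup>*" "x \<in> V" for x y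
    using that by (induction rule: rtrancl_induct) (use assms in auto)
  then show ?thesis by (auto simp: components_def quotient_def)
qed

lemma finite_components: "finite V \<Longrightarrow> finite (components V S)"
  by (simp add: components_def quotient_def)

lemma components_nonempty: "B \<in> components V S \<Longrightarrow> B \<noteq> {}"
  by (auto simp: components_def quotient_def)

lemma components_disjoint:
  "B \<in> components V S \<Longrightarrow> C \<in> components V S \<Longrightarrow> B \<noteq> C \<Longrightarrow> B \<inter> C = {}"
  using quotient_disj[OF equiv_weakly_connected[of S], of B C]
  by (auto simp: components_def quotient_def)

lemma edge_in_component:
  assumes "(x, y) \<in> S" "x \<in> V"
  shows "\<exists>B\<in>components V S. x \<in> B \<and> y \<in> B"
proof
  show "(S \<union> S\<inverse>)\<^sup>* `` {x} \<in> components V S"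
    using assms(2) by (auto simp: components_def intro: quotientI)
qed (use assms in auto)

lemma card_dipath: "is_dipath B F \<Longrightarrow> finite B \<and> card F + 1 = card B"
proof -
  assume "is_dipath B F"
  then obtain vs where vs: "vs \<noteq> []" "distinct vs" "set vs = B" "F = set (zip vs (tl vs))"
    by (auto simp: is_dipath_def)
  have "card F = length (zip vs (tl vs))"
    unfolding vs(4) using distinct_zipI1[OF vs(2)] by (rule distinct_card)
  moreover have "card B = length vs"
    unfolding vs(3)[symmetric] using vs(2) by (rule distinct_card)
  ultimately show ?thesis using vs(1,3) by (cases vs) auto
qed

lemma card_dicycle: "is_dicycle B F \<Longrightarrow> finite B \<and> card F = card B"
proof -
  assume "is_dicycle B F"
  then obtain vs where vs: "vs \<noteq> []" "distinct vs" "set vs = B" "F = set (zip vs (rotate1 vs))"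
    by (auto simp: is_dicycle_def)
  have "card F = length (zip vs (rotate1 vs))"
    unfolding vs(4) using distinct_zipI1[OF vs(2)] by (rule distinct_card)
  moreover have "card B = length vs"
    unfolding vs(3)[symmetric] using vs(2) by (rule distinct_card)
  ultimately show ?thesis using vs(3) by auto
qed

lemma not_dipath_and_dicycle: "is_dipath B F \<Longrightarrow> \<not> is_dicycle B F"
  using card_dipath card_dicycle by force

lemma dicycle_out_edge: "is_dicycle B F \<Longrightarrow> v \<in> B \<Longrightarrow> \<exists>w\<in>B. (v, w) \<in> F"
proof -
  assume "is_dicycle B F" "v \<in> B"
  then obtain vs i where vs: "set vs = B" "F = set (zip vs (rotate1 vs))" "i < length vs" "v = vs ! i"
    by (auto simp: is_dicycle_def in_set_conv_nth)
  then have "(v, rotate1 vs ! i) \<in> F" "rotate1 vs ! i \<in> set (rotate1 vs)"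
    by (auto simp: set_zip simp del: set_rotate1)
  then show ?thesis using vs(1) by auto
qed

text \<open>
  Both kinds of blocks contain the path through their vertices in order, so they are connected.
\<close>

lemma hd_reaches: "x \<in> set vs \<Longrightarrow> (hd vs, x) \<in> (set (zip vs (tl vs)))\<^sup>*"
proof (induction vs)
  case (Cons v vs)
  show ?case
  proof (cases "x = v")
    case False
    then have x: "x \<in> set vs" using Cons.prems by simp
    then obtain w ws where ws: "vs = w # ws" by (cases vs) auto
    have "set (zip vs (tl vs)) \<subseteq> set (zip (v # vs) vs)" by (auto simp: ws)
    then have "(w, x) \<in> (set (zip (v # vs) vs))\<^sup>*"
      using Cons.IH[OF x] rtrancl_mono[THEN subsetD] ws by (metis list.sel(1))
    moreover have "(v, w) \<in> set (zip (v # vs) vs)" by (simp add: ws)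
    ultimately show ?thesis by (auto intro: converse_rtrancl_into_rtrancl)
  qed simp
qed simp

lemma dipath_or_dicycle_connected:
  assumes "is_dipath B F \<or> is_dicycle B F" "x \<in> B" "y \<in> B"
  shows "(x, y) \<in> (F \<union> F\<inverse>)\<^sup>*"
proof -
  obtain vs where vs: "set vs = B" "set (zip vs (tl vs)) \<subseteq> F"
  proof (cases "is_dipath B F")
    case False
    then obtain vs where vs: "vs \<noteq> []" "set vs = B" "F = set (zip vs (rotate1 vs))"
      using assms(1) by (auto simp: is_dicycle_def)
    obtain w ws where ws: "vs = w # ws" using vs(1) by (cases vs) auto
    have "set (zip vs (tl vs)) \<subseteq> set (zip vs (rotate1 vs))"
    proof
      fix p assume "p \<in> set (zip vs (tl vs))"
      then obtain i where i: "i < length ws" "p = (vs ! i, ws ! i)"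
        by (auto simp: ws set_zip)
      then have "p = (vs ! i, rotate1 vs ! i)" "i < min (length vs) (length (rotate1 vs))"
        by (simp_all add: ws nth_append)
      then show "p \<in> set (zip vs (rotate1 vs))" unfolding set_zip by blast
    qed
    then show thesis using that vs by simp
  qed (auto simp: is_dipath_def that)
  have hd: "(hd vs, z) \<in> (F \<union> F\<inverse>)\<^sup>*" if "z \<in> B" for z
    using hd_reaches[of z vs] that vs rtrancl_mono[of "set (zip vs (tl vs))" "F \<union> F\<inverse>"] by auto
  have "sym ((F \<union> F\<inverse>)\<^sup>*)" by (rule sym_rtrancl) (auto simp: sym_def)
  then have "(x, hd vs) \<in> (F \<union> F\<inverse>)\<^sup>*" using hd[OF assms(2)] by (rule symD)
  with hd[OF assms(3)] show ?thesis by (rule rtrancl_trans[rotated])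
qed

text \<open>
  No edge leaves a block, so components are at most as large as blocks; blocks are connected, so
  components are at least as large.
\<close>

lemma components_eqI:
  assumes union: "\<Union>P = V" and ne: "\<And>B. B \<in> P \<Longrightarrow> B \<noteq> {}"
    and disj: "\<And>B C. B \<in> P \<Longrightarrow> C \<in> P \<Longrightarrow> B \<inter> C \<noteq> {} \<Longrightarrow> B = C"
    and edges: "\<And>x y. (x, y) \<in> E \<Longrightarrow> \<exists>B\<in>P. x \<in> B \<and> y \<in> B"
    and blocks: "\<And>B. B \<in> P \<Longrightarrow> is_dipath B (E \<inter> B \<times> B) \<or> is_dicycle B (E \<inter> B \<times> B)"
  shows "components V E = P"
proof -
  have cls: "(E \<union> E\<inverse>)\<^sup>* `` {x} = B" if B: "B \<in> P" "x \<in> B" for B x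
  proof (intro equalityI subsetI)
    fix y assume "y \<in> (E \<union> E\<inverse>)\<^sup>* `` {x}"
    then have "(x, y) \<in> (E \<union> E\<inverse>)\<^sup>*" by simp
    then show "y \<in> B"
    proof (induction rule: rtrancl_induct)
      case (step y z)
      then obtain C where C: "C \<in> P" "y \<in> C" "z \<in> C" using edges by blast
      have "C = B" by (rule disj) (use C B step.IH in auto)
      then show ?case using C by simp
    qed (rule B)
  next
    fix y assume "y \<in> B"
    let ?F = "E \<inter> B \<times> B"
    have "(x, y) \<in> (?F \<union> ?F\<inverse>)\<^sup>*"
      by (rule dipath_or_dicycle_connected[OF blocks[OF B(1)] B(2) \<open>y \<in> B\<close>])
    moreover have "(?F \<union> ?F\<inverse>)\<^sup>* \<subseteq> (E \<union> E\<inverse>)\<^sup>*" by (rule rtrancl_mono) auto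
    ultimately show "y \<in> (E \<union> E\<inverse>)\<^sup>* `` {x}" by auto
  qed
  show ?thesis
  proof (intro equalityI subsetI)
    fix B assume "B \<in> components V E"
    then obtain x where x: "x \<in> V" "B = (E \<union> E\<inverse>)\<^sup>* `` {x}"
      unfolding components_def by (rule quotientE) simp
    then obtain C where "C \<in> P" "x \<in> C" using union by auto
    then show "B \<in> P" using cls x(2) by simp
  next
    fix B assume B: "B \<in> P"
    then obtain x where x: "x \<in> B" using ne by auto
    then have "x \<in> V" using B union by auto
    then have "(E \<union> E\<inverse>)\<^sup>* `` {x} \<in> components V E" unfolding components_def by (rule quotientI)
    then show "B \<in> components V E" using cls[OF B x] by simp
  qed
qed

text \<open>A path has one vertex more than it has edges, a cycle equally many.\<close>

lemma cover_statistics: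
  assumes V: "finite V" "E \<subseteq> V \<times> V" and S: "S \<in> path_cycle_covers V E"
  shows "card S + card (path_blocks V S) = card V"
    and "sum_mset (block_sizes (path_blocks V S)) + sum_mset (block_sizes (cycle_blocks V S)) = card V"
    and "block_sizes (path_blocks V S) \<in> partitions"
    and "block_sizes (cycle_blocks V S) \<in> partitions"
    and "size (block_sizes (path_blocks V S)) = card (path_blocks V S)"
proof -
  let ?C = "components V S" and ?P = "path_blocks V S" and ?Q = "cycle_blocks V S"
  have SV: "S \<subseteq> V \<times> V" using S V by (auto simp: path_cycle_covers_def)
  then have finS: "finite S" using V(1) finite_subset by blast
  have finC: "finite ?C" using V(1) by (rule finite_components)
  have blocks: "is_dipath B (S \<inter> B \<times> B) \<or> is_dicycle B (S \<inter> B \<times> B)" if "B \<in> ?C" for B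
    using S that by (auto simp: path_cycle_covers_def)
  have PQ: "?P \<union> ?Q = ?C" "?P \<inter> ?Q = {}"
    using blocks not_dipath_and_dicycle by (auto simp: path_blocks_def cycle_blocks_def)
  have finPQ: "finite ?P" "finite ?Q" using finC PQ(1) by (metis finite_Un)+
  have finB: "finite B" if "B \<in> ?C" for B
    using that Union_components[OF SV] V(1) by (metis Union_upper finite_subset)
  have "card V = card (\<Union>B\<in>?C. B)" using Union_components[OF SV] by simp
  also have "\<dots> = (\<Sum>B\<in>?C. card B)"
  proof (rule card_UN_disjoint)
    show "\<forall>B\<in>?C. \<forall>C\<in>?C. B \<noteq> C \<longrightarrow> B \<inter> C = {}"
      by (intro ballI impI components_disjoint)
  qed (use finC finB in auto)
  finally have cardV: "card V = (\<Sum>B\<in>?C. card B)" .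
  have "S = (\<Union>B\<in>?C. S \<inter> B \<times> B)" using edge_in_component[of _ _ S V] SV by fast
  then have "card S = card (\<Union>B\<in>?C. S \<inter> B \<times> B)" by simp
  also have "\<dots> = (\<Sum>B\<in>?C. card (S \<inter> B \<times> B))"
  proof (rule card_UN_disjoint)
    show "\<forall>B\<in>?C. \<forall>C\<in>?C. B \<noteq> C \<longrightarrow> (S \<inter> B \<times> B) \<inter> (S \<inter> C \<times> C) = {}"
    proof (intro ballI impI)
      fix B C assume "B \<in> ?C" "C \<in> ?C" "B \<noteq> C"
      then have "B \<inter> C = {}" by (rule components_disjoint)
      then show "(S \<inter> B \<times> B) \<inter> (S \<inter> C \<times> C) = {}" by auto
    qed
  qed (use finC finS in auto)
  finally have cardS: "card S = (\<Sum>B\<in>?C. card (S \<inter> B \<times> B))" .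
  have "card B = card (S \<inter> B \<times> B) + (if B \<in> ?P then 1 else 0)" if "B \<in> ?C" for B
    using blocks[OF that] card_dipath[of B "S \<inter> B \<times> B"] card_dicycle[of B "S \<inter> B \<times> B"]
      not_dipath_and_dicycle that by (auto simp: path_blocks_def)
  then have "card V = (\<Sum>B\<in>?C. card (S \<inter> B \<times> B) + (if B \<in> ?P then 1 else 0))"
    unfolding cardV by (rule sum.cong[OF refl])
  also have "\<dots> = card S + card (?C \<inter> ?P)"
    unfolding cardS sum.distrib using finC by (simp add: sum.If_cases)
  also have "?C \<inter> ?P = ?P" using PQ by auto
  finally show "card S + card ?P = card V" by simp
  have "sum_mset (block_sizes X) = (\<Sum>B\<in>X. card B)" for X :: "'a set set"
    by (simp add: block_sizes_def sum_unfold_sum_mset)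
  then show "sum_mset (block_sizes ?P) + sum_mset (block_sizes ?Q) = card V"
    unfolding cardV PQ(1)[symmetric] using finPQ PQ(2) by (simp add: sum.union_disjoint)
  have "block_sizes X \<in> partitions" if "X \<subseteq> ?C" for X
  proof -
    have "finite X" using that finC finite_subset by blast
    moreover have "card B \<noteq> 0" if "B \<in> X" for B
      using that \<open>X \<subseteq> ?C\<close> finB components_nonempty by (metis card_0_eq subsetD)
    then have "0 \<notin> card ` X" by (metis imageE)
    ultimately show ?thesis by (simp add: block_sizes_def partitions_def)
  qed
  then show "block_sizes ?P \<in> partitions" "block_sizes ?Q \<in> partitions" using PQ by auto
  show "size (block_sizes ?P) = card ?P" by (simp add: block_sizes_def)
qed


section \<open>Covers of a disjoint union of paths and cycles\<close>

lemma mset_parts [simp]: "mset (parts lam) = lam"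
  by (simp add: parts_def)

lemma parts_pos: "lam \<in> partitions \<Longrightarrow> i < length (parts lam) \<Longrightarrow> 0 < parts lam ! i"
  by (metis gr0I mem_Collect_eq mset_parts nth_mem_mset partitions_def)

definition nth_path :: "nat multiset \<Rightarrow> nat \<Rightarrow> pc_vertex set" where
  "nth_path lam i = {Inl (i, j) | j. j < parts lam ! i}"

definition nth_cycle :: "nat multiset \<Rightarrow> nat \<Rightarrow> pc_vertex set" where
  "nth_cycle mu i = {Inr (i, j) | j. j < parts mu ! i}"

lemma dipath_nth_path:
  assumes "lam \<in> partitions" "i < length (parts lam)"
  shows "is_dipath (nth_path lam i) (pc_edges lam mu \<inter> nth_path lam i \<times> nth_path lam i)"
proof -
  let ?n = "parts lam ! i"
  let ?vs = "map (\<lambda>j. Inl (i, j)) [0..<?n] :: pc_vertex list"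
  have n: "0 < ?n" using assms by (rule parts_pos)
  have "pc_edges lam mu \<inter> nth_path lam i \<times> nth_path lam i
      = (\<lambda>j. (Inl (i, j), Inl (i, j + 1))) ` {j. j + 1 < ?n}"
    using assms(2) by (auto simp: pc_edges_def nth_path_def)
  also have "\<dots> = (\<lambda>j. (?vs ! j, tl ?vs ! j)) ` {j. j + 1 < ?n}"
    by (rule image_cong) (auto simp: nth_tl)
  also have "\<dots> = set (zip ?vs (tl ?vs))"
  proof -
    have "{j. j + 1 < ?n} = {j. j < min (length ?vs) (length (tl ?vs))}" by auto
    then show ?thesis unfolding set_zip by (simp only: setcompr_eq_image)
  qed
  finally show ?thesis
    unfolding is_dipath_def using n
    by (intro exI[of _ ?vs]) (auto simp: nth_path_def distinct_map inj_on_def)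
qed

lemma dicycle_nth_cycle:
  assumes "mu \<in> partitions" "i < length (parts mu)"
  shows "is_dicycle (nth_cycle mu i) (pc_edges lam mu \<inter> nth_cycle mu i \<times> nth_cycle mu i)"
proof -
  let ?n = "parts mu ! i"
  let ?vs = "map (\<lambda>j. Inr (i, j)) [0..<?n] :: pc_vertex list"
  have n: "0 < ?n" using assms by (rule parts_pos)
  have "pc_edges lam mu \<inter> nth_cycle mu i \<times> nth_cycle mu i
      = (\<lambda>j. (Inr (i, j), Inr (i, (j + 1) mod ?n))) ` {j. j < ?n}"
    using assms(2) n by (auto simp: pc_edges_def nth_cycle_def)
  also have "\<dots> = (\<lambda>j. (?vs ! j, rotate1 ?vs ! j)) ` {j. j < ?n}"
    using n by (intro image_cong) (auto simp: nth_rotate1)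
  also have "\<dots> = set (zip ?vs (rotate1 ?vs))"
  proof -
    have "{j. j < ?n} = {j. j < min (length ?vs) (length (rotate1 ?vs))}" by auto
    then show ?thesis unfolding set_zip by (simp only: setcompr_eq_image)
  qed
  finally show ?thesis
    unfolding is_dicycle_def using n
    by (intro exI[of _ ?vs]) (auto simp: nth_cycle_def distinct_map inj_on_def)
qed

lemma finite_pc_verts: "finite (pc_verts lam mu)"
proof -
  have "pc_verts lam mu = (\<Union>i<length (parts lam). nth_path lam i)
      \<union> (\<Union>i<length (parts mu). nth_cycle mu i)"
    by (auto simp: pc_verts_def nth_path_def nth_cycle_def)
  then show ?thesis by (simp add: nth_path_def nth_cycle_def)
qed

lemma pc_edges_subset: "pc_edges lam mu \<subseteq> pc_verts lam mu \<times> pc_verts lam mu"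
  by (auto simp: pc_edges_def pc_verts_def)

text \<open>
  Block sizes are taken over a set of blocks, so equal parts are counted correctly only if the
  blocks are distinct for distinct indices.
\<close>

lemma block_sizes_image:
  assumes "inj_on f {..<length xs}" "\<And>i. i < length xs \<Longrightarrow> card (f i) = xs ! i"
  shows "block_sizes (f ` {..<length xs}) = mset xs"
proof -
  have "block_sizes (f ` {..<length xs}) = image_mset (\<lambda>i. card (f i)) (mset_set {..<length xs})"
    using assms(1) by (simp add: block_sizes_def multiset.map_comp comp_def
        flip: image_mset_mset_set)
  also have "\<dots> = image_mset (\<lambda>i. xs ! i) (mset_set {..<length xs})"
    by (rule image_mset_cong) (simp add: assms(2))
  also have "\<dots> = mset (map (\<lambda>i. xs ! i) [0..<length xs])"
    by (simp add: atLeast0LessThan)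
  also have "\<dots> = mset xs" by (simp add: map_nth)
  finally show ?thesis .
qed

lemma full_cover:
  assumes lam: "lam \<in> partitions" and mu: "mu \<in> partitions"
  defines "V \<equiv> pc_verts lam mu" and "E \<equiv> pc_edges lam mu"
  shows "E \<in> path_cycle_covers V E"
    and "block_sizes (path_blocks V E) = lam"
    and "block_sizes (cycle_blocks V E) = mu"
proof -
  let ?A = "nth_path lam ` {..<length (parts lam)}" and ?B = "nth_cycle mu ` {..<length (parts mu)}"
  have paths: "is_dipath B (E \<inter> B \<times> B)" if "B \<in> ?A" for B
    using that dipath_nth_path[OF lam] by (auto simp: E_def)
  have cycles: "is_dicycle B (E \<inter> B \<times> B)" if "B \<in> ?B" for B
    using that dicycle_nth_cycle[OF mu] by (auto simp: E_def)
  have comps: "components V E = ?A \<union> ?B"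
  proof (rule components_eqI)
    show "\<Union>(?A \<union> ?B) = V" by (auto simp: V_def pc_verts_def nth_path_def nth_cycle_def)
    show "B \<noteq> {}" if "B \<in> ?A \<union> ?B" for B
      using that parts_pos[OF lam] parts_pos[OF mu] by (auto simp: nth_path_def nth_cycle_def)
    show "B = C" if "B \<in> ?A \<union> ?B" "C \<in> ?A \<union> ?B" "B \<inter> C \<noteq> {}" for B C
      using that by (auto simp: nth_path_def nth_cycle_def)
    show "\<exists>B\<in>?A \<union> ?B. x \<in> B \<and> y \<in> B" if edge: "(x, y) \<in> E" for x y
    proof -
      consider i j where "i < length (parts lam)" "j + 1 < parts lam ! i"
          "x = Inl (i, j)" "y = Inl (i, j + 1)"
        | i j where "i < length (parts mu)" "j < parts mu ! i"
          "x = Inr (i, j)" "y = Inr (i, (j + 1) mod parts mu ! i)"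
        using edge by (auto simp: E_def pc_edges_def)
      then show ?thesis
      proof cases
        case 1
        then have "x \<in> nth_path lam i" "y \<in> nth_path lam i" by (auto simp: nth_path_def)
        with 1(1) show ?thesis by blast
      next
        case 2
        then have "x \<in> nth_cycle mu i" "y \<in> nth_cycle mu i" by (auto simp: nth_cycle_def)
        with 2(1) show ?thesis by blast
      qed
    qed
    show "is_dipath B (E \<inter> B \<times> B) \<or> is_dicycle B (E \<inter> B \<times> B)" if "B \<in> ?A \<union> ?B" for B
      using that paths cycles by blast
  qed
  then show "E \<in> path_cycle_covers V E"
    using paths cycles by (auto simp: path_cycle_covers_def)
  have "path_blocks V E = ?A" "cycle_blocks V E = ?B"
    unfolding path_blocks_def cycle_blocks_def comps
    using paths cycles not_dipath_and_dicycle by blast+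
  moreover have "block_sizes ?A = mset (parts lam)"
  proof (rule block_sizes_image)
    \<comment> \<open>As all parts are positive, the blocks have a vertex number \<open>0\<close>, which shows their index.\<close>
    show "inj_on (nth_path lam) {..<length (parts lam)}"
    proof (rule inj_onI)
      fix i k assume i: "i \<in> {..<length (parts lam)}" and eq: "nth_path lam i = nth_path lam k"
      have "Inl (i, 0) \<in> nth_path lam i"
        using i parts_pos[OF lam] by (simp add: nth_path_def)
      then have "Inl (i, 0) \<in> nth_path lam k" unfolding eq .
      then show "i = k" by (simp add: nth_path_def)
    qed
    have "nth_path lam i = (\<lambda>j. Inl (i, j)) ` {..<parts lam ! i}" for i
      by (auto simp: nth_path_def)
    then show "card (nth_path lam i) = parts lam ! i" for i
      by (simp add: card_image inj_on_def)
  qed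
  moreover have "block_sizes ?B = mset (parts mu)"
  proof (rule block_sizes_image)
    show "inj_on (nth_cycle mu) {..<length (parts mu)}"
    proof (rule inj_onI)
      fix i k assume i: "i \<in> {..<length (parts mu)}" and eq: "nth_cycle mu i = nth_cycle mu k"
      have "Inr (i, 0) \<in> nth_cycle mu i"
        using i parts_pos[OF mu] by (simp add: nth_cycle_def)
      then have "Inr (i, 0) \<in> nth_cycle mu k" unfolding eq .
      then show "i = k" by (simp add: nth_cycle_def)
    qed
    have "nth_cycle mu i = (\<lambda>j. Inr (i, j)) ` {..<parts mu ! i}" for i
      by (auto simp: nth_cycle_def)
    then show "card (nth_cycle mu i) = parts mu ! i" for i
      by (simp add: card_image inj_on_def)
  qed
  ultimately show "block_sizes (path_blocks V E) = lam" "block_sizes (cycle_blocks V E) = mu"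
    by simp_all
qed

text \<open>
  On a union of paths the position along the path increases along every edge, so the vertex of
  maximal position in a cycle could have no successor.
\<close>

lemma cycle_blocks_paths_only:
  assumes S: "S \<subseteq> pc_edges lam {#}"
  shows "cycle_blocks V S = {}"
proof (rule ccontr)
  assume "cycle_blocks V S \<noteq> {}"
  then obtain B where B: "B \<in> components V S" "is_dicycle B (S \<inter> B \<times> B)"
    by (auto simp: cycle_blocks_def)
  define position :: "pc_vertex \<Rightarrow> nat" where "position v = (case v of Inl p \<Rightarrow> snd p | Inr p \<Rightarrow> 0)" for v
  have "finite B" "B \<noteq> {}" using B card_dicycle components_nonempty by blast+
  then have "Max (position ` B) \<in> position ` B" by (intro Max_in) auto
  then obtain v where v: "v \<in> B" "position v = Max (position ` B)" by auto
  obtain w where w: "w \<in> B" "(v, w) \<in> S" using dicycle_out_edge[OF B(2) v(1)] by auto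
  have "(v, w) \<in> pc_edges lam {#}" using S w(2) by auto
  then have "position v < position w" by (auto simp: pc_edges_def parts_def position_def)
  moreover have "position w \<le> position v" using v(2) w(1) \<open>finite B\<close> by simp
  ultimately show False by simp
qed


section \<open>Expansion of the path-cycle symmetric functions\<close>

lemma y_vars_eq: "y_vars = - x_vars"
  by (auto simp: x_vars_def y_vars_def) (metis sum.exhaust_sel rangeI)

lemma infinite_x_vars: "infinite x_vars" and infinite_y_vars: "infinite y_vars"
  by (auto simp: x_vars_def y_vars_def dest!: finite_imageD)

text \<open>
  The digraph with path lengths \<open>\<lambda>\<close> and cycle lengths \<open>\<mu>\<close> has this many edges; applied to the
  block sizes of a cover it is the number of edges of the cover.
\<close>

definition edge_number :: "nat multiset \<times> nat multiset \<Rightarrow> nat" where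
  "edge_number = (\<lambda>(lam, mu). sum_mset lam + sum_mset mu - size lam)"

text \<open>
  The cover by all edges contributes the diagonal term.  The others have fewer edges, so
  that their products come earlier.  The two choices of the index set \<open>I\<close> serve the functions of two sets
  of variables and those of one.
\<close>

lemma Xi_tilde2_triangular:
  assumes lam: "lam \<in> partitions" and mu: "mu \<in> partitions"
    and I: "I = partitions \<times> partitions \<or> I = partitions \<times> {{#}} \<and> mu = {#}"
  shows "\<exists>a. a \<noteq> 0 \<and> Xi_tilde2 lam mu - mscale a (mixed_product x_vars (lam, mu))
    \<in> mfps.span (mixed_product x_vars ` {j \<in> I. edge_number j < edge_number (lam, mu)})"
proof -
  define V E where "V = pc_verts lam mu" and "E = pc_edges lam mu"
  define type where "type S = (block_sizes (path_blocks V S), block_sizes (cycle_blocks V S))" for S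
  define a :: "_ \<Rightarrow> rat" where "a S = 1 / fact (card (path_blocks V S))
      * (\<Prod>k\<in>set_mset (fst (type S)). fact (count (fst (type S)) k))" for S
  have V: "finite V" "E \<subseteq> V \<times> V"
    by (simp_all add: V_def E_def finite_pc_verts pc_edges_subset)
  then have finE: "finite E" using finite_subset by blast
  let ?C = "path_cycle_covers V E"
  have "?C \<subseteq> Pow E" by (auto simp: path_cycle_covers_def)
  then have finC: "finite ?C" using finE finite_subset by blast
  have E: "E \<in> ?C" "type E = (lam, mu)"
    using full_cover[OF lam mu] by (simp_all add: V_def E_def type_def)
  have edges: "edge_number (type S) = card S" if "S \<in> ?C" for S
    using cover_statistics[OF V that] by (simp add: edge_number_def type_def)
  have lower: "type S \<in> {j \<in> I. edge_number j < edge_number (lam, mu)}" if S: "S \<in> ?C - {E}" for S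
  proof -
    have "S \<subset> E" using S by (auto simp: path_cycle_covers_def)
    then have "card S < card E" using finE by (intro psubset_card_mono)
    then have "edge_number (type S) < edge_number (lam, mu)"
      using edges[of S] edges[OF E(1)] S E(2) by simp
    moreover have "type S \<in> I"
    proof -
      have "type S \<in> partitions \<times> partitions"
        using cover_statistics[OF V, of S] S by (simp add: type_def)
      moreover have "snd (type S) = {#}" if "mu = {#}"
        using cycle_blocks_paths_only[of S lam V] \<open>S \<subset> E\<close> that
        by (simp add: type_def E_def block_sizes_def psubset_eq)
      ultimately show ?thesis using I by (auto simp: mem_Times_iff)
    qed
    ultimately show ?thesis by simp
  qed
  have "Xi_tilde2 lam mu = (\<Sum>S\<in>?C. mscale (a S) (mixed_product x_vars (type S)))"
    unfolding Xi_tilde2_def Let_def V_def[symmetric] E_def[symmetric]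
    by (rule sum.cong) (simp_all add: mixed_product_def augmented_monomial_sym_def
        mscale_times_left mscale_mscale a_def type_def y_vars_eq)
  also have "\<dots> = mscale (a E) (mixed_product x_vars (lam, mu))
      + (\<Sum>S\<in>?C - {E}. mscale (a S) (mixed_product x_vars (type S)))"
    using sum.remove[OF finC E(1), of "\<lambda>S. mscale (a S) (mixed_product x_vars (type S))"]
    by (simp add: E(2))
  finally have "Xi_tilde2 lam mu - mscale (a E) (mixed_product x_vars (lam, mu))
      = (\<Sum>S\<in>?C - {E}. mscale (a S) (mixed_product x_vars (type S)))"
    by simp
  also have "\<dots> \<in> mfps.span (mixed_product x_vars ` {j \<in> I. edge_number j < edge_number (lam, mu)})"
    by (intro mfps.span_sum mfps.span_scale mfps.span_base imageI lower)
  finally show ?thesis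
    by (intro exI[of _ "a E"] conjI) (auto simp: a_def)
qed

theorem proposition16:
  shows "is_linear_basis Xi_tilde partitions (symmetric_functions {x_vars}) \<and>
    is_linear_basis (\<lambda>(lam, mu). Xi_tilde2 lam mu) (partitions \<times> partitions)
      (symmetric_functions {x_vars, y_vars})"
proof
  have inf: "infinite x_vars" "infinite (- x_vars)"
    using infinite_x_vars infinite_y_vars by (simp_all add: y_vars_eq)
  let ?Xi = "\<lambda>(lam, mu). Xi_tilde2 lam mu"
  show "is_linear_basis ?Xi (partitions \<times> partitions) (symmetric_functions {x_vars, y_vars})"
    unfolding y_vars_eq
    by (rule triangular_is_linear_basis[OF mixed_product_basis2[OF inf], where rank = edge_number])
      (clarsimp, rule Xi_tilde2_triangular, simp_all)
  have "{#} \<in> partitions" by (simp add: partitions_def)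
  then have basis: "is_linear_basis ?Xi (partitions \<times> {{#}}) (symmetric_functions {x_vars})"
    by (intro triangular_is_linear_basis[OF mixed_product_basis1[OF inf], where rank = edge_number])
      (clarsimp, rule Xi_tilde2_triangular, simp_all)
  \<comment> \<open>The family indexed by \<open>lam\<close> is the one indexed by the pairs \<open>(lam, {#})\<close>.\<close>
  have eq: "Xi_tilde = ?Xi \<circ> (\<lambda>lam. (lam, {#}))"
    by (simp add: fun_eq_iff Xi_tilde_def)
  have img: "(\<lambda>lam. (lam, {#})) ` partitions = partitions \<times> {{#}}" by auto
  have "Xi_tilde ` partitions = ?Xi ` (partitions \<times> {{#}})"
    unfolding eq image_comp[symmetric] img ..
  moreover have "inj_on Xi_tilde partitions"
    unfolding eq
  proof (rule comp_inj_on)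
    show "inj_on ?Xi ((\<lambda>lam. (lam, {#})) ` partitions)"
      using basis by (simp add: is_linear_basis_def img)
  qed (simp add: inj_on_def)
  ultimately show "is_linear_basis Xi_tilde partitions (symmetric_functions {x_vars})"
    using basis by (simp add: is_linear_basis_def)
qed

end
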